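(* Let $\ell$ be a real number with $\ell\geq 1+\frac{4}{N}$ and $\ell\geq 2$. Let $f:\mathbb{R}\to\mathbb{R}$ satisfy $f(0)=0$ and $$|f(u)-f(v)|\leq C|u-v|\big(|u|^{\ell-1}e^{\lambda u^2}+|v|^{\ell-1}e^{\lambda v^2}\big)\quad\text{for all }u,v\in\mathbb{R},$$ for some constants $C>0$, $\lambda>0$. Let $u_0\in\exp L^2_0(\mathbb{R}^N)$ with $\|u_0\|_{\exp L^2}$ sufficiently small, and let $u\in C([0,\infty);\exp L^2_0(\mathbb{R}^N))$ be the global solution of $$\partial_t u-\Delta u=f(u),\quad t>0,\ x\in\mathbb{R}^N,\qquad u(0)=u_0.$$ Then there exists $C>0$ such that $\|u(t)\|_{L^p}\leq C\,t^{-\sigma}$ for all $t>0$, where $\sigma=\frac{1}{\ell-1}-\frac{N}{2p}>0$, with $\frac{N(\ell-1)}{2}<p<\infty$ if $N\geq 4$, and $\max\{\ell,\frac{2N(\ell-1)}{4-N}\}\leq p\leq\infty$ if $N<4$.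
   Context: The Orlicz space $\exp L^2(\mathbb{R}^N)$ is the set of $u\in L^1_{loc}(\mathbb{R}^N)$ such that $\int_{\mathbb{R}^N}(e^{|u(x)|^2/\alpha^2}-1)\,dx<\infty$ for some $\alpha>0$, with the Luxemburg norm $\|u\|_{\exp L^2}=\inf\{\alpha>0:\int_{\mathbb{R}^N}(e^{|u(x)|^2/\alpha^2}-1)\,dx\leq 1\}$; $\exp L^2_0(\mathbb{R}^N)$ is the closure of $C_0^\infty(\mathbb{R}^N)$ in this norm. For such $f$ and $\|u_0\|_{\exp L^2}$ small, the heat equation above has a global solution $u\in C([0,\infty);\exp L^2_0)$ satisfying $u(t)=e^{t\Delta}u_0+\int_0^t e^{(t-s)\Delta}f(u(s))\,ds$, where $e^{t\Delta}$ is the heat semigroup. *)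

theory Defs
  imports "HOL-Analysis.Analysis"
begin

text \<open>C^infinity: differentiable everywhere, and the class is closed under all
partial derivatives (hence all partial derivatives of all orders exist and are
differentiable, in particular continuous).\<close>
definition smooth_fn :: "(real^'n \<Rightarrow> real) \<Rightarrow> bool" where
  "smooth_fn g \<longleftrightarrow> (\<exists>S. g \<in> S \<and> (\<forall>h\<in>S. (\<forall>x. h differentiable (at x)) \<and>
      (\<forall>i. (\<lambda>x. frechet_derivative h (at x) (axis i 1)) \<in> S)))"

definition C0_infty :: "(real^'n \<Rightarrow> real) set" where
  "C0_infty = {g. smooth_fn g \<and> compact (closure {x. g x \<noteq> 0})}"

definition orlicz_mod :: "(real^'n \<Rightarrow> real) \<Rightarrow> real \<Rightarrow> ennreal" where
  "orlicz_mod u \<alpha> = (\<integral>\<^sup>+ x. ennreal (exp (\<bar>u x\<bar>^2 / \<alpha>^2) - 1) \<partial>lborel)"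

definition loc_integrable :: "(real^'n \<Rightarrow> real) \<Rightarrow> bool" where
  "loc_integrable u \<longleftrightarrow> u \<in> borel_measurable lborel \<and>
     (\<forall>K. compact K \<longrightarrow> set_integrable lborel K u)"

definition expL2 :: "(real^'n \<Rightarrow> real) set" where
  "expL2 = {u. loc_integrable u \<and> (\<exists>\<alpha>>0. orlicz_mod u \<alpha> < \<infinity>)}"

definition expL2_norm :: "(real^'n \<Rightarrow> real) \<Rightarrow> real" where
  "expL2_norm u = Inf {\<alpha>. \<alpha> > 0 \<and> orlicz_mod u \<alpha> \<le> 1}"

definition expL2_0 :: "(real^'n \<Rightarrow> real) set" where
  "expL2_0 = {u. u \<in> expL2 \<and> (\<exists>\<phi>. (\<forall>k. \<phi> k \<in> C0_infty) \<and>
       (\<lambda>k. expL2_norm (\<lambda>x. u x - \<phi> k x)) \<longlonglongrightarrow> 0)}"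

definition heat :: "real \<Rightarrow> (real^'n \<Rightarrow> real) \<Rightarrow> real^'n \<Rightarrow> real" where
  "heat t g x = (\<integral> y. ((4 * pi * t) powr (- real CARD('n) / 2) *
       exp (- (dist x y)\<^sup>2 / (4 * t)) * g y) \<partial>lborel)"

definition global_mild_solution ::
  "(real \<Rightarrow> real) \<Rightarrow> (real^'n \<Rightarrow> real) \<Rightarrow> (real \<Rightarrow> real^'n \<Rightarrow> real) \<Rightarrow> bool" where
  "global_mild_solution f u0 u \<longleftrightarrow>
     (\<forall>t\<ge>0. u t \<in> expL2_0) \<and>
     (\<forall>t\<ge>0. ((\<lambda>s. expL2_norm (\<lambda>x. u s x - u t x)) \<longlongrightarrow> 0) (at t within {0..})) \<and>
     u 0 = u0 \<and>
     (\<forall>t>0. AE x in lborel.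
        set_integrable lborel {0..t} (\<lambda>s. heat (t - s) (\<lambda>y. f (u s y)) x) \<and>
        u t x = heat t u0 x + (\<integral>s\<in>{0..t}. heat (t - s) (\<lambda>y. f (u s y)) x \<partial>lborel))"

definition Lp_norm_le :: "ereal \<Rightarrow> (real^'n \<Rightarrow> real) \<Rightarrow> real \<Rightarrow> bool" where
  "Lp_norm_le p g M \<longleftrightarrow>
     (if p = \<infinity> then (AE x in lborel. \<bar>g x\<bar> \<le> M)
      else M \<ge> 0 \<and> (\<integral>\<^sup>+ x. ennreal (\<bar>g x\<bar> powr real_of_ereal p) \<partial>lborel)
              \<le> ennreal (M powr real_of_ereal p))"

end

theory Submission
  imports Defs "HOL-Probability.Probability"
begin

text \<open>
  Write \<open>a = 1/(l - 1)\<close>. The whole range of exponents follows from two scale-invariant bounds with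
  one small \<open>\<delta>\<close>: the Luxemburg norm of \<open>u t\<close> is at most \<open>\<delta>\<close>, and \<open>\<bar>u t\<bar> \<le> \<delta> t\<^sup>-\<^sup>a\<close> almost everywhere.
  The first controls \<open>\<integral>\<bar>u t\<bar>\<^sup>q\<close> for the critical exponent \<open>q = n(l - 1)/2 \<ge> 2\<close>, and interpolating with
  the second gives \<open>t\<^sup>-\<^sup>\<sigma>\<close> in every \<open>L\<^sup>p\<close>, \<open>q < p \<le> \<infinity>\<close>, in every dimension.

  If both bounds hold up to time \<open>s\<close>, then for \<open>b \<ge> 0\<close> with \<open>(l - b) r \<ge> 2\<close> one has
  \<open>\<parallel>f (u s)\<parallel>\<^sub>r \<le> K \<delta>\<^sup>l s\<^sup>-\<^sup>a\<^sup>b\<close>: the sup bound is used on \<open>\<bar>u\<bar>\<^sup>b\<close>, the Luxemburg bound on \<open>\<bar>u\<bar>\<^sup>l\<^sup>-\<^sup>b exp (lam u\<^sup>2)\<close>.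
  Choosing \<open>(r, b)\<close> suitably, the Duhamel term is \<open>O(\<delta>\<^sup>l t\<^sup>-\<^sup>a)\<close> in the supremum and \<open>O(\<delta>\<^sup>l)\<close> in \<open>L\<^sup>2 \<inter> L\<^sup>\<infinity>\<close>,
  hence in \<open>exp L\<^sup>2\<close>. Since \<open>l > 1\<close>, a continuity argument in time closes both bounds for small data; the
  sup norm of \<open>u t\<close> is not known to be continuous, so the argument advances by a fixed step \<open>h\<close>, and on the
  last step only the Luxemburg bound is used inside the Duhamel integral.
\<close>

subsection \<open>Heat semigroup estimates\<close>

text \<open>The Gaussian factor of \<open>heat\<close>, separated from the data so that its total
  mass, symmetry and joint measurability can be stated on their own.\<close>

definition heat_kernel :: "real \<Rightarrow> real^'n \<Rightarrow> real^'n \<Rightarrow> real" where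
  "heat_kernel t x y = (4 * pi * t) powr (- real CARD('n) / 2) * exp (- (dist x y)\<^sup>2 / (4 * t))"

lemma heat_eq_kernel: "heat t g x = (\<integral>y. heat_kernel t x y * g y \<partial>lborel)"
  by (simp add: heat_def heat_kernel_def)

lemma heat_kernel_nonneg [simp]: "0 \<le> heat_kernel t x y"
  by (simp add: heat_kernel_def)

lemma heat_kernel_commute: "heat_kernel t x y = heat_kernel t y x"
  by (simp add: heat_kernel_def dist_commute)

lemma heat_kernel_measurable [measurable]:
  "(\<lambda>(x, y). heat_kernel t x y) \<in> borel_measurable (borel \<Otimes>\<^sub>M borel)"
  unfolding heat_kernel_def split_beta by measurable

lemma heat_kernel_le:
  fixes x y :: "real^'n"
  assumes "t > 0"
  shows "heat_kernel t x y \<le> t powr (- real CARD('n) / 2)"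
proof -
  have "4 * pi * t \<ge> 1 * t"
    using assms pi_gt3 by (intro mult_right_mono) auto
  then have "(4 * pi * t) powr (- real CARD('n) / 2) \<le> t powr (- real CARD('n) / 2)"
    using assms by (intro powr_mono2') auto
  moreover have "exp (- (dist x y)\<^sup>2 / (4 * t)) \<le> 1"
    using assms by simp
  ultimately show ?thesis
    unfolding heat_kernel_def
    by (metis exp_ge_zero mult.right_neutral mult_mono powr_ge_zero)
qed

lemma nn_integral_normal_density:
  assumes "\<sigma> > 0"
  shows "(\<integral>\<^sup>+x. ennreal (normal_density \<mu> \<sigma> x) \<partial>lborel) = 1"
  using assms by (simp add: nn_integral_eq_integral)

text \<open>In an orthonormal basis the kernel is a product of one-dimensional normal densities with
  means \<open>x \<bullet> b\<close>, so its integral factorises into integrals equal to 1. The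
  variance is \<open>2 * t\<close>, which matches the \<open>4 * t\<close> in the exponent.\<close>

lemma nn_integral_heat_kernel:
  fixes x :: "real^'n"
  assumes t: "t > 0"
  shows "(\<integral>\<^sup>+y. ennreal (heat_kernel t x y) \<partial>lborel) = 1"
proof -
  define \<sigma> where "\<sigma> = sqrt (2 * t)"
  have s: "\<sigma> > 0" and s2: "\<sigma>\<^sup>2 = 2 * t" using t by (auto simp: \<sigma>_def)
  have eq: "heat_kernel t x y = (\<Prod>b\<in>Basis. normal_density (x \<bullet> b) \<sigma> (y \<bullet> b))" for y
  proof -
    have "(\<Prod>b\<in>(Basis::(real^'n) set). normal_density (x \<bullet> b) \<sigma> (y \<bullet> b))
        = (1 / sqrt (4 * pi * t)) ^ CARD('n) * (\<Prod>b\<in>(Basis::(real^'n) set). exp (- (y \<bullet> b - x \<bullet> b)\<^sup>2 / (4 * t)))"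
    proof -
      have "normal_density (x \<bullet> b) \<sigma> (y \<bullet> b) = (1 / sqrt (4 * pi * t)) * exp (- (y \<bullet> b - x \<bullet> b)\<^sup>2 / (4 * t))" for b
        by (simp add: normal_density_def s2 mult_ac)
      then show ?thesis
        by (simp only: prod.distrib prod_constant DIM_cart DIM_real mult_1_right)
    qed
    also have "(\<Prod>b\<in>(Basis::(real^'n) set). exp (- (y \<bullet> b - x \<bullet> b)\<^sup>2 / (4 * t)))
        = exp (- (dist x y)\<^sup>2 / (4 * t))"
    proof -
      have "(dist x y)\<^sup>2 = (\<Sum>b\<in>Basis. (y \<bullet> b - x \<bullet> b)\<^sup>2)"
        by (simp add: euclidean_dist_l2[of x y] L2_set_def dist_real_def sum_nonneg power2_commute)
      then show ?thesis
        by (simp add: exp_sum[symmetric] sum_negf sum_divide_distrib)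
    qed
    also have "(1 / sqrt (4 * pi * t)) ^ CARD('n) = (4 * pi * t) powr (- real CARD('n) / 2)"
    proof -
      have "(1 / sqrt (4 * pi * t)) = (4 * pi * t) powr (-1/2)"
        using t by (simp add: powr_minus powr_half_sqrt field_simps)
      then show ?thesis
        using t by (simp add: powr_powr flip: powr_realpow)
    qed
    finally show ?thesis by (simp add: heat_kernel_def)
  qed
  have "(\<integral>\<^sup>+y. ennreal (heat_kernel t x y) \<partial>lborel)
      = (\<integral>\<^sup>+y. (\<Prod>b\<in>Basis. ennreal (normal_density (x \<bullet> b) \<sigma> (y \<bullet> b))) \<partial>lborel)"
    by (simp add: eq prod_ennreal)
  also have "\<dots> = (\<Prod>b\<in>(Basis::(real^'n) set). (\<integral>\<^sup>+y. ennreal (normal_density (x \<bullet> b) \<sigma> y) \<partial>lborel))"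
    by (subst nn_integral_lborel_prod) auto
  also have "\<dots> = 1"
    by (simp add: nn_integral_normal_density s)
  finally show ?thesis .
qed

lemma nn_integral_heat_kernel':
  fixes y :: "real^'n"
  assumes "t > 0"
  shows "(\<integral>\<^sup>+x. ennreal (heat_kernel t x y) \<partial>lborel) = 1"
  by (subst heat_kernel_commute) (rule nn_integral_heat_kernel[OF assms])

lemma integrable_heat_kernel:
  assumes "t > 0"
  shows "integrable lborel (heat_kernel t (x::real^'n))"
  using nn_integral_heat_kernel[OF assms, of x]
  by (intro integrableI_nonneg) (auto)

section \<open>Jensen's inequality and smoothing estimates for the heat flow\<close>

lemma prob_space_heat_kernel:
  assumes "t > 0"
  shows "prob_space (density lborel (\<lambda>y. ennreal (heat_kernel t (x::real^'n) y)))"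
  by (rule prob_spaceI) (simp add: emeasure_density nn_integral_heat_kernel[OF assms])

text \<open>A non-integrable \<open>g\<close> is harmless: its Bochner integral is \<open>0\<close> and \<open>\<phi> 0 = 0\<close>.\<close>
lemma (in prob_space) jensen_nn_integral:
  fixes g :: "'a \<Rightarrow> real" and \<phi> :: "real \<Rightarrow> real"
  assumes [measurable]: "g \<in> borel_measurable M" "\<phi> \<in> borel_measurable borel"
    and nonneg: "\<And>y. 0 \<le> \<phi> y" and zero: "\<phi> 0 = 0"
    and support: "\<And>m. \<exists>c. \<forall>y. \<phi> m + c * (y - m) \<le> \<phi> y"
  shows "ennreal (\<phi> (\<integral>x. g x \<partial>M)) \<le> (\<integral>\<^sup>+x. ennreal (\<phi> (g x)) \<partial>M)"
proof (cases "integrable M g \<and> (\<integral>\<^sup>+x. ennreal (\<phi> (g x)) \<partial>M) < \<infinity>")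
  case True
  then have int: "integrable M g" and int\<phi>: "integrable M (\<lambda>x. \<phi> (g x))"
    by (auto intro!: integrableI_nonneg simp: nonneg)
  define m where "m = (\<integral>x. g x \<partial>M)"
  \<comment> \<open>The supporting line at the mean \<open>m\<close> integrates to
    \<open>\<phi> m\<close>, because its linear part has mean zero. Such lines are the form in which
    convexity of \<open>\<phi>\<close> is assumed.\<close>
  obtain c where c: "\<And>y. \<phi> m + c * (y - m) \<le> \<phi> y" using support by blast
  have "\<phi> m = (\<integral>x. \<phi> m + c * (g x - m) \<partial>M)"
    using int by (simp add: m_def prob_space)
  also have "\<dots> \<le> (\<integral>x. \<phi> (g x) \<partial>M)"
    using int int\<phi> c by (intro integral_mono) auto
  finally show ?thesis
    using int\<phi> by (simp add: m_def nn_integral_eq_integral nonneg)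
next
  case False
  then show ?thesis
    by (cases "integrable M g") (auto simp: not_integrable_integral_eq zero not_less top_unique)
qed

text \<open>\<open>heat t g x\<close> is the mean of \<open>g\<close> under the Gaussian probability
  measure centred at \<open>x\<close>, so this is Jensen's inequality for that measure.\<close>

lemma heat_jensen:
  fixes g :: "real^'n \<Rightarrow> real" and \<phi> :: "real \<Rightarrow> real"
  assumes t: "t > 0" and [measurable]: "g \<in> borel_measurable borel" "\<phi> \<in> borel_measurable borel"
    and "\<And>y. 0 \<le> \<phi> y" "\<phi> 0 = 0"
    and "\<And>m. \<exists>c. \<forall>y. \<phi> m + c * (y - m) \<le> \<phi> y"
  shows "ennreal (\<phi> (heat t g x)) \<le> (\<integral>\<^sup>+y. ennreal (heat_kernel t x y) * ennreal (\<phi> (g y)) \<partial>lborel)"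
proof -
  interpret prob_space "density lborel (\<lambda>y. ennreal (heat_kernel t x y))"
    by (rule prob_space_heat_kernel[OF t])
  have "heat t g x = (\<integral>y. g y \<partial>density lborel (\<lambda>y. ennreal (heat_kernel t x y)))"
    by (subst integral_density) (auto simp: heat_eq_kernel)
  then show ?thesis
    using jensen_nn_integral[of g \<phi>] assms by (simp add: nn_integral_density)
qed

lemma heat_measurable [measurable]:
  fixes g :: "real^'n \<Rightarrow> real"
  assumes [measurable]: "g \<in> borel_measurable borel"
  shows "heat t g \<in> borel_measurable borel"
proof -
  have "(\<lambda>x. \<integral>y. heat_kernel t x y * g y \<partial>lborel) \<in> borel_measurable borel"
    by measurable
  then show ?thesis by (simp add: heat_eq_kernel[abs_def])
qed

text \<open>Integrate the pointwise Jensen bound in \<open>x\<close>, exchange the integrals and use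
  that the kernel also has mass 1 in its first variable. Powers give the L^r contraction, and
  \<open>exp (y^2 / \<alpha>^2) - 1\<close> gives the contraction of the Orlicz modular.\<close>

lemma heat_jensen_integral:
  fixes g :: "real^'n \<Rightarrow> real" and \<phi> :: "real \<Rightarrow> real"
  assumes t: "t > 0" and [measurable]: "g \<in> borel_measurable borel" "\<phi> \<in> borel_measurable borel"
    and "\<And>y. 0 \<le> \<phi> y" "\<phi> 0 = 0"
    and "\<And>m. \<exists>c. \<forall>y. \<phi> m + c * (y - m) \<le> \<phi> y"
  shows "(\<integral>\<^sup>+x. ennreal (\<phi> (heat t g x)) \<partial>lborel) \<le> (\<integral>\<^sup>+y. ennreal (\<phi> (g y)) \<partial>lborel)"
proof -
  have "(\<integral>\<^sup>+x. ennreal (\<phi> (heat t g x)) \<partial>lborel)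
     \<le> (\<integral>\<^sup>+x. (\<integral>\<^sup>+y. ennreal (heat_kernel t x y) * ennreal (\<phi> (g y)) \<partial>lborel) \<partial>lborel)"
    using assms by (intro nn_integral_mono heat_jensen) auto
  also have "\<dots> = (\<integral>\<^sup>+y. (\<integral>\<^sup>+x. ennreal (heat_kernel t x y) * ennreal (\<phi> (g y)) \<partial>lborel) \<partial>lborel)"
    by (rule lborel_pair.Fubini') measurable
  also have "\<dots> = (\<integral>\<^sup>+y. ennreal (\<phi> (g y)) \<partial>lborel)"
    by (simp add: nn_integral_multc nn_integral_heat_kernel'[OF t])
  finally show ?thesis .
qed

text \<open>Bernoulli's inequality: a convex power lies above its tangent at 1. The point 0 is
  treated separately because convexity is taken on the open half line; there the claim is
  \<open>1 - r \<le> 0\<close>.\<close>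

lemma powr_ge_one_plus:
  fixes z r :: real
  assumes "z \<ge> 0" "r \<ge> 1"
  shows "1 + r * (z - 1) \<le> z powr r"
proof (cases "z = 0")
  case False
  have c: "convex_on {0<..} (\<lambda>x::real. x powr r)" using assms by (intro powr_convex)
  have d: "((\<lambda>x::real. x powr r) has_real_derivative r) (at 1 within {0<..})"
    by (auto intro!: derivative_eq_intros)
  have "z powr r - 1 powr r \<ge> r * (z - 1)"
    using assms False by (intro convex_on_imp_above_tangent[OF c _ _ _ d]) (auto simp: interior_open)
  then show ?thesis by simp
qed (use assms in auto)

text \<open>Dividing by \<open>\<bar>m\<bar>\<close> reduces to Bernoulli's inequality at
  \<open>\<bar>y\<bar> / \<bar>m\<bar>\<close>. At \<open>m = 0\<close> the horizontal line
  supports.\<close>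

lemma abs_powr_support:
  fixes m r :: real
  assumes r: "r \<ge> 1"
  shows "\<exists>c. \<forall>y. \<bar>m\<bar> powr r + c * (y - m) \<le> \<bar>y\<bar> powr r"
proof (cases "m = 0")
  case True
  then show ?thesis by (intro exI[of _ 0]) auto
next
  case False
  show ?thesis
  proof (intro exI allI)
    fix y
    have "1 + r * (y / m - 1) \<le> 1 + r * (\<bar>y\<bar> / \<bar>m\<bar> - 1)"
      using r by (metis abs_divide abs_ge_self add_left_mono diff_right_mono mult_left_mono order_trans zero_le_one)
    also have "\<dots> \<le> (\<bar>y\<bar> / \<bar>m\<bar>) powr r"
      using r by (intro powr_ge_one_plus) auto
    finally have "\<bar>m\<bar> powr r * (1 + r * (y / m - 1)) \<le> \<bar>m\<bar> powr r * (\<bar>y\<bar> / \<bar>m\<bar>) powr r"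
      by (intro mult_left_mono) auto
    also have "\<bar>m\<bar> powr r * (\<bar>y\<bar> / \<bar>m\<bar>) powr r = \<bar>y\<bar> powr r"
      using False by (simp flip: powr_mult)
    finally show "\<bar>m\<bar> powr r + (\<bar>m\<bar> powr r * r / m) * (y - m) \<le> \<bar>y\<bar> powr r"
      using False by (simp add: field_simps)
  qed
qed

text \<open>The L^r to L^infinity smoothing estimate: Jensen with the r-th power, the uniform kernel
  bound, then an r-th root.\<close>

lemma heat_sup_le:
  fixes g :: "real^'n \<Rightarrow> real"
  assumes t: "t > 0" and r: "r \<ge> 1" and B: "B \<ge> 0" and [measurable]: "g \<in> borel_measurable borel"
    and g: "(\<integral>\<^sup>+y. ennreal (\<bar>g y\<bar> powr r) \<partial>lborel) \<le> ennreal (B powr r)"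
  shows "\<bar>heat t g x\<bar> \<le> t powr (- real CARD('n) / (2 * r)) * B"
proof -
  define k where "k = t powr (- real CARD('n) / 2)"
  have "ennreal (\<bar>heat t g x\<bar> powr r)
      \<le> (\<integral>\<^sup>+y. ennreal (heat_kernel t x y) * ennreal (\<bar>g y\<bar> powr r) \<partial>lborel)"
    using r by (intro heat_jensen[OF t] abs_powr_support) auto
  also have "\<dots> \<le> (\<integral>\<^sup>+y. ennreal k * ennreal (\<bar>g y\<bar> powr r) \<partial>lborel)"
    unfolding k_def
    by (intro nn_integral_mono mult_right_mono ennreal_leI heat_kernel_le[OF t]) auto
  also have "\<dots> = ennreal k * (\<integral>\<^sup>+y. ennreal (\<bar>g y\<bar> powr r) \<partial>lborel)"
    by (rule nn_integral_cmult) measurable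
  also have "\<dots> \<le> ennreal k * ennreal (B powr r)"
    by (intro mult_left_mono g) auto
  also have "\<dots> = ennreal (k * B powr r)"
    by (simp add: ennreal_mult k_def)
  finally have *: "\<bar>heat t g x\<bar> powr r \<le> k * B powr r"
    by (simp add: k_def)
  also have "k * B powr r = (t powr (- real CARD('n) / (2 * r)) * B) powr r"
    using r B t by (simp add: k_def powr_mult powr_powr)
  finally have **: "\<bar>heat t g x\<bar> powr r \<le> (t powr (- real CARD('n) / (2 * r)) * B) powr r" .
  show ?thesis
  proof (rule ccontr)
    assume "\<not> ?thesis"
    then have "(t powr (- real CARD('n) / (2 * r)) * B) powr r < \<bar>heat t g x\<bar> powr r"
      using r B by (intro powr_less_mono2) auto
    with ** show False by simp
  qed
qed

text \<open>Interpolation between the two previous facts: \<open>2 - r\<close> powers of the heat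
  flow are bounded by its supremum \<open>A\<close>, and the remaining \<open>r\<close> powers are
  integrated by the L^r contraction.\<close>

lemma heat_L2_le:
  fixes g :: "real^'n \<Rightarrow> real"
  assumes t: "t > 0" and r: "1 \<le> r" "r \<le> 2" and B: "B \<ge> 0" and [measurable]: "g \<in> borel_measurable borel"
    and g: "(\<integral>\<^sup>+y. ennreal (\<bar>g y\<bar> powr r) \<partial>lborel) \<le> ennreal (B powr r)"
  shows "(\<integral>\<^sup>+x. ennreal ((heat t g x)\<^sup>2) \<partial>lborel)
    \<le> ennreal ((t powr (- real CARD('n) / 2 * (1 / r - 1 / 2)) * B)\<^sup>2)"
proof -
  define A where "A = t powr (- real CARD('n) / (2 * r)) * B"
  have A: "A \<ge> 0" using B by (simp add: A_def)
  have int: "(\<integral>\<^sup>+x. ennreal (\<bar>heat t g x\<bar> powr r) \<partial>lborel) \<le> ennreal (B powr r)"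
    using r by (intro order_trans[OF heat_jensen_integral[OF t, of g "\<lambda>y. \<bar>y\<bar> powr r"] g] abs_powr_support) auto
  have "(heat t g x)\<^sup>2 \<le> A powr (2 - r) * \<bar>heat t g x\<bar> powr r" for x
  proof (cases "heat t g x = 0")
    case False
    have "(heat t g x)\<^sup>2 = \<bar>heat t g x\<bar> powr (2 - r) * \<bar>heat t g x\<bar> powr r"
      using False by (simp flip: powr_add)
    also have "\<dots> \<le> A powr (2 - r) * \<bar>heat t g x\<bar> powr r"
      unfolding A_def
      using r by (intro mult_right_mono powr_mono2 heat_sup_le[OF t _ B _ g]) auto
    finally show ?thesis .
  qed auto
  then have "(\<integral>\<^sup>+x. ennreal ((heat t g x)\<^sup>2) \<partial>lborel)
      \<le> (\<integral>\<^sup>+x. ennreal (A powr (2 - r)) * ennreal (\<bar>heat t g x\<bar> powr r) \<partial>lborel)"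
    by (intro nn_integral_mono) (simp add: ennreal_leI flip: ennreal_mult)
  also have "\<dots> = ennreal (A powr (2 - r)) * (\<integral>\<^sup>+x. ennreal (\<bar>heat t g x\<bar> powr r) \<partial>lborel)"
    by (rule nn_integral_cmult) measurable
  also have "\<dots> \<le> ennreal (A powr (2 - r)) * ennreal (B powr r)"
    by (intro mult_left_mono int) auto
  also have "\<dots> = ennreal (A powr (2 - r) * B powr r)"
    by (simp add: ennreal_mult)
  also have "A powr (2 - r) * B powr r = (t powr (- real CARD('n) / 2 * (1 / r - 1 / 2)) * B)\<^sup>2"
  proof (cases "B = 0")
    case False
    then have "B powr (2 - r) * B powr r = B\<^sup>2"
      using B by (simp flip: powr_add)
    moreover have "(t powr (- real CARD('n) / (2 * r))) powr (2 - r)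
        = (t powr (- real CARD('n) / 2 * (1 / r - 1 / 2)))\<^sup>2"
    proof -
      have "(t powr (- real CARD('n) / 2 * (1 / r - 1 / 2)))\<^sup>2
          = (t powr (- real CARD('n) / 2 * (1 / r - 1 / 2))) powr 2"
        using t by simp
      also have "\<dots> = (t powr (- real CARD('n) / (2 * r))) powr (2 - r)"
        unfolding powr_powr using r by (intro arg_cong[where f="\<lambda>z. t powr z"]) (simp add: field_simps)
      finally show ?thesis ..
    qed
    ultimately show ?thesis
      using B by (simp add: A_def powr_mult power_mult_distrib mult_ac)
  qed (use r in auto)
  finally show ?thesis .
qed

subsection \<open>Luxemburg norm and nonlinearity\<close>

text \<open>The line is the tangent at \<open>m\<close>. It lies below the graph by the tangent
  inequality for the square followed by \<open>1 + z \<le> exp z\<close>.\<close>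

lemma exp_sq_support:
  fixes m \<alpha> :: real
  shows "\<exists>c. \<forall>y. (exp (m\<^sup>2 / \<alpha>\<^sup>2) - 1) + c * (y - m) \<le> exp (y\<^sup>2 / \<alpha>\<^sup>2) - 1"
proof (intro exI allI)
  fix y
  have "m\<^sup>2 + 2 * m * (y - m) \<le> y\<^sup>2"
    using sum_squares_ge_zero[of "y - m" 0] by (simp add: power2_eq_square algebra_simps)
  then have "2 * m * (y - m) / \<alpha>\<^sup>2 \<le> y\<^sup>2 / \<alpha>\<^sup>2 - m\<^sup>2 / \<alpha>\<^sup>2"
    by (simp add: divide_right_mono flip: diff_divide_distrib)
  also have "1 + \<dots> \<le> exp (y\<^sup>2 / \<alpha>\<^sup>2 - m\<^sup>2 / \<alpha>\<^sup>2)"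
    by (rule exp_ge_add_one_self)
  finally have "exp (m\<^sup>2 / \<alpha>\<^sup>2) * (1 + 2 * m * (y - m) / \<alpha>\<^sup>2) \<le> exp (m\<^sup>2 / \<alpha>\<^sup>2) * exp (y\<^sup>2 / \<alpha>\<^sup>2 - m\<^sup>2 / \<alpha>\<^sup>2)"
    by (intro mult_left_mono) auto
  then show "(exp (m\<^sup>2 / \<alpha>\<^sup>2) - 1) + (exp (m\<^sup>2 / \<alpha>\<^sup>2) * (2 * m) / \<alpha>\<^sup>2) * (y - m) \<le> exp (y\<^sup>2 / \<alpha>\<^sup>2) - 1"
    by (simp add: algebra_simps flip: exp_add)
qed

text \<open>Only the terms of index 0 and \<open>m\<close> of the exponential series are kept;
  \<open>m \<ge> 1\<close> makes these indices distinct.\<close>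

lemma power_le_fact_exp:
  fixes w :: real
  assumes "w \<ge> 0" "m \<ge> 1"
  shows "w ^ m \<le> fact m * (exp w - 1)"
proof -
  have "(\<Sum>k\<in>{0, m}. w ^ k /\<^sub>R fact k) \<le> (\<Sum>k. w ^ k /\<^sub>R fact k)"
    using assms by (intro sum_le_suminf summable_exp_generic) auto
  then have "1 + w ^ m / fact m \<le> exp w"
    using assms by (simp add: exp_def divide_inverse mult.commute)
  then show ?thesis by (simp add: field_simps)
qed

text \<open>With \<open>w = v^2 / 2\<close> half of the exponent is kept in reserve: first the power
  is bounded by \<open>C * (exp w - 1)\<close>, then multiplication by \<open>exp w\<close> costs
  nothing since \<open>(exp w - 1) * exp w \<le> exp (2 * w) - 1\<close>.\<close>

lemma powr_exp_half_le:
  fixes q :: real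
  assumes q: "q \<ge> 2"
  obtains C where "C > 0" "\<And>v::real. \<bar>v\<bar> powr q * exp (v\<^sup>2 / 2) \<le> C * (exp (v\<^sup>2) - 1)"
proof -
  obtain m :: nat where m: "q \<le> real m" using real_arch_simple by blast
  with q have m1: "m \<ge> 1" by linarith
  \<comment> \<open>One constant for two regimes: for \<open>\<bar>v\<bar> \<le> 1\<close> the
    condition \<open>q \<ge> 2\<close> bounds the power by \<open>2 * w\<close>, and for larger
    \<open>v\<close> the exponent is raised to \<open>2 * m\<close>, which gives
    \<open>2 ^ m * w ^ m\<close>.\<close>
  define C :: real where "C = 2 ^ m * fact m"
  have "2 ^ 1 * 1 \<le> C"
    unfolding C_def using m1 by (intro mult_mono power_increasing fact_ge_1) auto
  then have C2: "C \<ge> 2" by simp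
  show ?thesis
  proof (rule that[of C])
    show "C > 0" using C2 by simp
    fix v :: real
    define w where "w = v\<^sup>2 / 2"
    have w: "w \<ge> 0" and v2: "v\<^sup>2 = 2 * w" by (auto simp: w_def)
    have ew: "w \<le> exp w - 1" "1 \<le> exp w" using exp_ge_add_one_self[of w] w by linarith+
    have "\<bar>v\<bar> powr q \<le> C * (exp w - 1)"
    proof (cases "\<bar>v\<bar> \<le> 1")
      case True
      have "\<bar>v\<bar> powr q \<le> \<bar>v\<bar> powr 2" using True q by (intro powr_mono') auto
      also have "\<dots> = 2 * w" by (cases "v = 0") (auto simp: w_def)
      also have "\<dots> \<le> C * (exp w - 1)" using C2 ew w by (intro mult_mono) auto
      finally show ?thesis .
    next
      case False
      have "\<bar>v\<bar> powr q \<le> \<bar>v\<bar> powr (real (2 * m))" using False m by (intro powr_mono) auto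
      also have "\<dots> = \<bar>v\<bar> ^ (2 * m)" using False by (subst powr_realpow) auto
      also have "\<dots> = 2 ^ m * w ^ m" by (simp add: power_mult v2 power_mult_distrib)
      also have "\<dots> \<le> C * (exp w - 1)"
        unfolding C_def mult.assoc using power_le_fact_exp[OF w m1] by simp
      finally show ?thesis .
    qed
    then have "\<bar>v\<bar> powr q * exp w \<le> C * (exp w - 1) * exp w"
      by (intro mult_right_mono) auto
    also have "\<dots> \<le> C * (exp (v\<^sup>2) - 1)"
      unfolding mult.assoc v2 mult_2 exp_add using C2 ew by (intro mult_left_mono) (auto simp: algebra_simps)
    finally show "\<bar>v\<bar> powr q * exp (v\<^sup>2 / 2) \<le> C * (exp (v\<^sup>2) - 1)"
      by (simp add: w_def)
  qed
qed

section \<open>Modular and Luxemburg norm\<close>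

lemma orlicz_mod_antimono:
  assumes "0 < \<alpha>" "\<alpha> \<le> \<beta>"
  shows "orlicz_mod u \<beta> \<le> orlicz_mod u \<alpha>"
  unfolding orlicz_mod_def using assms
  by (intro nn_integral_mono ennreal_leI diff_right_mono iffD2[OF exp_le_cancel_iff] divide_left_mono power_mono) auto

lemma expL2_norm_le:
  assumes "\<alpha> > 0" "orlicz_mod u \<alpha> \<le> 1"
  shows "expL2_norm u \<le> \<alpha>"
  unfolding expL2_norm_def using assms by (intro cInf_lower bdd_belowI[of _ 0]) auto

lemma expL2_measurable: "u \<in> expL2 \<Longrightarrow> u \<in> borel_measurable borel"
  by (simp add: expL2_def loc_integrable_def)

text \<open>Bernoulli's inequality for the base \<open>exp y\<close> and the exponent
  \<open>c\<close>: enlarging \<open>\<alpha>\<close> by the factor \<open>sqrt c\<close> divides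
  the modular by at least \<open>c\<close>.\<close>

lemma orlicz_mod_scale:
  assumes \<alpha>: "\<alpha> > 0" and c: "c \<ge> 1" and [measurable]: "u \<in> borel_measurable borel"
  shows "ennreal c * orlicz_mod u (\<alpha> * sqrt c) \<le> orlicz_mod u \<alpha>"
proof -
  have "c * (exp (\<bar>u x\<bar>\<^sup>2 / (\<alpha> * sqrt c)\<^sup>2) - 1) \<le> exp (\<bar>u x\<bar>\<^sup>2 / \<alpha>\<^sup>2) - 1" for x
  proof -
    define y where "y = \<bar>u x\<bar>\<^sup>2 / (\<alpha> * sqrt c)\<^sup>2"
    have "1 + c * (exp y - 1) \<le> exp y powr c" using c by (intro powr_ge_one_plus) auto
    also have "\<dots> = exp (\<bar>u x\<bar>\<^sup>2 / \<alpha>\<^sup>2)"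
      using c \<alpha> by (simp add: powr_def y_def power_mult_distrib)
    finally show ?thesis by (simp add: y_def)
  qed
  then show ?thesis
    unfolding orlicz_mod_def using c
    by (subst nn_integral_cmult[symmetric]) (auto intro!: nn_integral_mono ennreal_leI simp flip: ennreal_mult)
qed

text \<open>A finite modular is scaled below 1. Hence the set whose infimum is
  \<open>expL2_norm\<close> is nonempty, and for members of \<open>expL2\<close> the
  \<open>Inf\<close> is a genuine infimum.\<close>

lemma expL2_luxemburg:
  assumes u: "u \<in> expL2"
  shows "\<exists>\<alpha>>0. orlicz_mod u \<alpha> \<le> 1"
proof -
  from u obtain \<alpha> where \<alpha>: "\<alpha> > 0" "orlicz_mod u \<alpha> < \<infinity>" by (auto simp: expL2_def)
  then obtain M where M: "M \<ge> 0" "orlicz_mod u \<alpha> = ennreal M" by (cases "orlicz_mod u \<alpha>") auto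
  define c where "c = max 1 M"
  have c: "c \<ge> 1" "M \<le> c" by (auto simp: c_def)
  have "ennreal c * orlicz_mod u (\<alpha> * sqrt c) \<le> ennreal c * 1"
    using orlicz_mod_scale[OF \<alpha>(1) c(1) expL2_measurable[OF u]] M c
    by (metis ennreal_leI mult.right_neutral order_trans)
  then have "orlicz_mod u (\<alpha> * sqrt c) \<le> 1"
    using c by (subst (asm) ennreal_mult_le_mult_iff) auto
  then show ?thesis using \<alpha> c by (intro exI[of _ "\<alpha> * sqrt c"]) auto
qed

text \<open>By definition of the infimum some admissible value lies below \<open>\<beta>\<close>,
  and the modular decreases in its parameter. This converts strict bounds on the norm into bounds on
  the modular, which is what the integral estimates consume.\<close>

lemma expL2_norm_less:
  assumes "\<exists>\<alpha>>0. orlicz_mod u \<alpha> \<le> 1" "expL2_norm u < \<beta>"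
  shows "\<beta> > 0" "orlicz_mod u \<beta> \<le> 1"
proof -
  obtain \<alpha> where "\<alpha> > 0" "orlicz_mod u \<alpha> \<le> 1" "\<alpha> < \<beta>"
    using assms cInf_lessD[of "{\<alpha>. \<alpha> > 0 \<and> orlicz_mod u \<alpha> \<le> 1}" \<beta>]
    unfolding expL2_norm_def by auto
  then show "\<beta> > 0" "orlicz_mod u \<beta> \<le> 1"
    using orlicz_mod_antimono[of \<alpha> \<beta> u] by auto
qed

text \<open>The triangle inequality for the Luxemburg norm, at the level of modulars:
  \<open>(v + w) / (\<alpha> + \<beta>)\<close> is the convex combination of
  \<open>v / \<alpha>\<close> and \<open>w / \<beta>\<close> with weights \<open>p\<close> and
  \<open>q\<close>, and \<open>exp (y^2) - 1\<close> is convex.\<close>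

lemma orlicz_mod_add:
  assumes [measurable]: "v \<in> borel_measurable borel" "w \<in> borel_measurable borel"
    and \<alpha>: "\<alpha> > 0" "orlicz_mod v \<alpha> \<le> 1" and \<beta>: "\<beta> > 0" "orlicz_mod w \<beta> \<le> 1"
  shows "orlicz_mod (\<lambda>x. v x + w x) (\<alpha> + \<beta>) \<le> 1"
proof -
  define p q where "p = \<alpha> / (\<alpha> + \<beta>)" and "q = \<beta> / (\<alpha> + \<beta>)"
  have pq: "p > 0" "q > 0" "p + q = 1"
    using \<alpha> \<beta> by (auto simp: p_def q_def simp flip: add_divide_distrib)
  have le: "exp (\<bar>v x + w x\<bar>\<^sup>2 / (\<alpha> + \<beta>)\<^sup>2) - 1
      \<le> p * (exp (\<bar>v x\<bar>\<^sup>2 / \<alpha>\<^sup>2) - 1) + q * (exp (\<bar>w x\<bar>\<^sup>2 / \<beta>\<^sup>2) - 1)" for x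
  proof -
    define a b m where "a = v x / \<alpha>" and "b = w x / \<beta>" and "m = (v x + w x) / (\<alpha> + \<beta>)"
    have m: "m = p * a + q * b"
      using \<alpha> \<beta> by (simp add: m_def p_def q_def a_def b_def add_divide_distrib)
    obtain c where c: "\<And>y. (exp (m\<^sup>2) - 1) + c * (y - m) \<le> exp (y\<^sup>2) - 1"
      using exp_sq_support[of m 1] by auto
    have "p * ((exp (m\<^sup>2) - 1) + c * (a - m)) + q * ((exp (m\<^sup>2) - 1) + c * (b - m))
       \<le> p * (exp (a\<^sup>2) - 1) + q * (exp (b\<^sup>2) - 1)"
      using pq by (intro add_mono mult_left_mono c) auto
    moreover have "p * ((exp (m\<^sup>2) - 1) + c * (a - m)) + q * ((exp (m\<^sup>2) - 1) + c * (b - m))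
        = (p + q) * (exp (m\<^sup>2) - 1) + c * (p * a + q * b - (p + q) * m)"
      by (simp add: algebra_simps)
    ultimately have "exp (m\<^sup>2) - 1 \<le> p * (exp (a\<^sup>2) - 1) + q * (exp (b\<^sup>2) - 1)"
      using pq(3) m by simp
    then show ?thesis by (simp add: m_def a_def b_def power_divide)
  qed
  have "orlicz_mod (\<lambda>x. v x + w x) (\<alpha> + \<beta>)
     \<le> (\<integral>\<^sup>+x. ennreal p * ennreal (exp (\<bar>v x\<bar>\<^sup>2 / \<alpha>\<^sup>2) - 1) + ennreal q * ennreal (exp (\<bar>w x\<bar>\<^sup>2 / \<beta>\<^sup>2) - 1) \<partial>lborel)"
    unfolding orlicz_mod_def using le pq
    by (intro nn_integral_mono) (auto intro!: ennreal_leI simp flip: ennreal_mult ennreal_plus)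
  also have "\<dots> = ennreal p * orlicz_mod v \<alpha> + ennreal q * orlicz_mod w \<beta>"
    unfolding orlicz_mod_def by (simp add: nn_integral_add nn_integral_cmult)
  also have "\<dots> \<le> ennreal p * 1 + ennreal q * 1"
    using \<alpha> \<beta> by (intro add_mono mult_left_mono) auto
  also have "\<dots> = 1" using pq by (simp flip: ennreal_plus)
  finally show ?thesis .
qed

text \<open>The embedding of the intersection of L^2 and L^infinity into exp L^2. The factor 2 in
  \<open>2 * A\<close> keeps the exponent \<open>y\<close> below 1, where
  \<open>exp y - 1 \<le> 4 * y\<close>, and \<open>4 * y\<close> is exactly
  \<open>(w x)^2 / A^2\<close>.\<close>

lemma orlicz_mod_le_of_bounded:
  assumes A: "A > 0" and [measurable]: "w \<in> borel_measurable borel"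
    and bd: "AE x in lborel. \<bar>w x\<bar> \<le> A" and sq: "(\<integral>\<^sup>+x. ennreal ((w x)\<^sup>2) \<partial>lborel) \<le> ennreal (A\<^sup>2)"
  shows "orlicz_mod w (2 * A) \<le> 1"
proof -
  have "orlicz_mod w (2 * A) \<le> (\<integral>\<^sup>+x. ennreal (1 / A\<^sup>2) * ennreal ((w x)\<^sup>2) \<partial>lborel)"
    unfolding orlicz_mod_def
  proof (intro nn_integral_mono_AE, use bd in eventually_elim)
    case (elim x)
    define y where "y = \<bar>w x\<bar>\<^sup>2 / (2 * A)\<^sup>2"
    have "(w x)\<^sup>2 \<le> A\<^sup>2" using elim A by (intro abs_le_square_iff[THEN iffD1]) simp
    also have "\<dots> \<le> 4 * A\<^sup>2" by simp
    finally have y: "0 \<le> y" "y \<le> 1" using A by (auto simp: y_def power_mult_distrib field_simps)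
    have "exp y \<le> 1 + y + y\<^sup>2" using y by (intro exp_bound) auto
    also have "y\<^sup>2 \<le> y" using y by (simp add: power2_eq_square mult_left_le)
    finally have "exp y - 1 \<le> 4 * y" using y by simp
    also have "\<dots> = 1 / A\<^sup>2 * (w x)\<^sup>2" by (simp add: y_def power_mult_distrib)
    finally show ?case by (simp add: y_def ennreal_leI flip: ennreal_mult)
  qed
  also have "\<dots> = ennreal (1 / A\<^sup>2) * (\<integral>\<^sup>+x. ennreal ((w x)\<^sup>2) \<partial>lborel)"
    by (rule nn_integral_cmult) measurable
  also have "\<dots> \<le> ennreal (1 / A\<^sup>2) * ennreal (A\<^sup>2)" by (intro mult_left_mono sq) auto
  also have "\<dots> = 1" using A by (simp flip: ennreal_mult)
  finally show ?thesis .
qed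

lemma orlicz_mod_heat_le:
  fixes g :: "real^'n \<Rightarrow> real"
  assumes "t > 0" and [measurable]: "g \<in> borel_measurable borel"
  shows "orlicz_mod (heat t g) \<alpha> \<le> orlicz_mod g \<alpha>"
  unfolding orlicz_mod_def power2_abs
  by (intro heat_jensen_integral[OF assms(1)] exp_sq_support) auto

text \<open>After rescaling by \<open>\<delta>\<close>, the condition on \<open>c\<close> keeps the
  extra exponential within the half exponent allowed by \<open>powr_exp_half_le\<close>. The case
  \<open>c = 0\<close> is the embedding of exp L^2 into L^q.\<close>

lemma orlicz_powr_exp_integral_le:
  fixes q :: real
  assumes q: "q \<ge> 2"
  obtains C where "C > 0"
    "\<And>(v::real^'n \<Rightarrow> real) \<delta> c. \<lbrakk>v \<in> borel_measurable borel; \<delta> > 0; c * \<delta>\<^sup>2 \<le> 1 / 2; orlicz_mod v \<delta> \<le> 1\<rbrakk>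
      \<Longrightarrow> (\<integral>\<^sup>+x. ennreal (\<bar>v x\<bar> powr q * exp (c * (v x)\<^sup>2)) \<partial>lborel) \<le> ennreal (C * \<delta> powr q)"
proof -
  from powr_exp_half_le[OF q] obtain C
    where C: "C > 0" "\<And>v::real. \<bar>v\<bar> powr q * exp (v\<^sup>2 / 2) \<le> C * (exp (v\<^sup>2) - 1)" by blast
  show ?thesis
  proof (rule that[OF C(1)])
    fix v :: "real^'n \<Rightarrow> real" and \<delta> c :: real
    assume [measurable]: "v \<in> borel_measurable borel"
      and \<delta>: "\<delta> > 0" and c: "c * \<delta>\<^sup>2 \<le> 1 / 2" and mod: "orlicz_mod v \<delta> \<le> 1"
    have "\<bar>v x\<bar> powr q * exp (c * (v x)\<^sup>2) \<le> (C * \<delta> powr q) * (exp (\<bar>v x\<bar>\<^sup>2 / \<delta>\<^sup>2) - 1)" for x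
    proof -
      define w where "w = v x / \<delta>"
      have v: "v x = \<delta> * w" using \<delta> by (simp add: w_def)
      have "\<bar>v x\<bar> powr q * exp (c * (v x)\<^sup>2) = \<delta> powr q * (\<bar>w\<bar> powr q * exp ((c * \<delta>\<^sup>2) * w\<^sup>2))"
        using \<delta> by (simp add: v abs_mult powr_mult power_mult_distrib mult_ac)
      also have "\<dots> \<le> \<delta> powr q * (\<bar>w\<bar> powr q * exp (1 / 2 * w\<^sup>2))"
        using c by (intro mult_left_mono iffD2[OF exp_le_cancel_iff] mult_right_mono) auto
      also have "\<dots> \<le> \<delta> powr q * (C * (exp (w\<^sup>2) - 1))"
        using C(2)[of w] by (intro mult_left_mono) auto
      finally show ?thesis by (simp add: w_def power_divide mult_ac)
    qed
    then have "(\<integral>\<^sup>+x. ennreal (\<bar>v x\<bar> powr q * exp (c * (v x)\<^sup>2)) \<partial>lborel)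
        \<le> (\<integral>\<^sup>+x. ennreal (C * \<delta> powr q) * ennreal (exp (\<bar>v x\<bar>\<^sup>2 / \<delta>\<^sup>2) - 1) \<partial>lborel)"
      using C(1) by (intro nn_integral_mono) (auto intro!: ennreal_leI simp flip: ennreal_mult)
    also have "\<dots> = ennreal (C * \<delta> powr q) * orlicz_mod v \<delta>"
      unfolding orlicz_mod_def by (rule nn_integral_cmult) measurable
    also have "\<dots> \<le> ennreal (C * \<delta> powr q) * 1" by (intro mult_left_mono mod) auto
    finally show "(\<integral>\<^sup>+x. ennreal (\<bar>v x\<bar> powr q * exp (c * (v x)\<^sup>2)) \<partial>lborel) \<le> ennreal (C * \<delta> powr q)"
      by simp
  qed
qed

text \<open>Split \<open>\<bar>v\<bar> powr l\<close> into the powers \<open>b\<close> and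
  \<open>l - b\<close>. The supremum bound \<open>\<delta> * m\<close> absorbs the first, the
  modular integrates the second together with the exponential. The alternative \<open>b = 0\<close>
  serves times at which no supremum bound is available yet.\<close>

lemma nonlinearity_Lr:
  fixes f :: "real \<Rightarrow> real" and l b r C0 lam :: real
  assumes C0: "C0 > 0" and fb: "\<And>v. \<bar>f v\<bar> \<le> C0 * \<bar>v\<bar> powr l * exp (lam * v\<^sup>2)"
    and r: "r > 0" and b: "b \<ge> 0" and lbr: "(l - b) * r \<ge> 2"
  obtains K where "K > 0"
    "\<And>(v::real^'n \<Rightarrow> real) \<delta> m. \<lbrakk>v \<in> borel_measurable borel; \<delta> > 0; r * lam * \<delta>\<^sup>2 \<le> 1 / 2;
       orlicz_mod v \<delta> \<le> 1; m > 0; b = 0 \<or> (AE x in lborel. \<bar>v x\<bar> \<le> \<delta> * m)\<rbrakk>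
      \<Longrightarrow> (\<integral>\<^sup>+x. ennreal (\<bar>f (v x)\<bar> powr r) \<partial>lborel) \<le> ennreal ((K * \<delta> powr l * m powr b) powr r)"
proof -
  from orlicz_powr_exp_integral_le[OF lbr, where 'n='n] obtain C where C: "C > 0"
    "\<And>(v::real^'n \<Rightarrow> real) \<delta> c. \<lbrakk>v \<in> borel_measurable borel; \<delta> > 0; c * \<delta>\<^sup>2 \<le> 1 / 2; orlicz_mod v \<delta> \<le> 1\<rbrakk>
      \<Longrightarrow> (\<integral>\<^sup>+x. ennreal (\<bar>v x\<bar> powr ((l - b) * r) * exp (c * (v x)\<^sup>2)) \<partial>lborel) \<le> ennreal (C * \<delta> powr ((l - b) * r))"
    by blast
  define K where "K = C0 * C powr (1 / r)"
  have K: "K > 0" using C0 C by (simp add: K_def)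
  show ?thesis
  proof (rule that[OF K])
    fix v :: "real^'n \<Rightarrow> real" and \<delta> m :: real
    assume v [measurable]: "v \<in> borel_measurable borel" and \<delta>: "\<delta> > 0" "r * lam * \<delta>\<^sup>2 \<le> 1 / 2"
      and mod: "orlicz_mod v \<delta> \<le> 1" and m: "m > 0" and bd: "b = 0 \<or> (AE x in lborel. \<bar>v x\<bar> \<le> \<delta> * m)"
    define D where "D = C0 powr r * (\<delta> * m) powr (b * r)"
    have D: "D \<ge> 0" by (simp add: D_def)
    \<comment> \<open>If \<open>b = 0\<close>, the right side is 1 and the left side is 1 or, where
      \<open>v\<close> vanishes, 0.\<close>
    from bd have "AE x in lborel. \<bar>v x\<bar> powr (b * r) \<le> (\<delta> * m) powr (b * r)"
      using m \<delta> r b by (auto intro!: powr_mono2)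
    then have "AE x in lborel. \<bar>f (v x)\<bar> powr r \<le> D * (\<bar>v x\<bar> powr ((l - b) * r) * exp (r * lam * (v x)\<^sup>2))"
    proof eventually_elim
      case (elim x)
      have "\<bar>f (v x)\<bar> powr r \<le> (C0 * \<bar>v x\<bar> powr l * exp (lam * (v x)\<^sup>2)) powr r"
        using r by (intro powr_mono2 fb) auto
      also have "\<dots> = C0 powr r * (\<bar>v x\<bar> powr (b * r) * \<bar>v x\<bar> powr ((l - b) * r)) * exp (r * lam * (v x)\<^sup>2)"
      proof -
        have "exp (lam * (v x)\<^sup>2) powr r = exp (r * lam * (v x)\<^sup>2)"
          by (simp add: powr_def mult_ac)
        moreover have "b * r + (l - b) * r = l * r" by (simp add: algebra_simps)
        ultimately show ?thesis
          using C0 by (simp add: powr_mult powr_powr flip: powr_add)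
      qed
      also have "\<dots> \<le> C0 powr r * ((\<delta> * m) powr (b * r) * \<bar>v x\<bar> powr ((l - b) * r)) * exp (r * lam * (v x)\<^sup>2)"
        using elim by (intro mult_right_mono mult_left_mono) auto
      finally show ?case by (simp add: D_def mult_ac)
    qed
    then have "(\<integral>\<^sup>+x. ennreal (\<bar>f (v x)\<bar> powr r) \<partial>lborel)
        \<le> (\<integral>\<^sup>+x. ennreal D * ennreal (\<bar>v x\<bar> powr ((l - b) * r) * exp (r * lam * (v x)\<^sup>2)) \<partial>lborel)"
      using D by (intro nn_integral_mono_AE) (auto intro!: ennreal_leI simp flip: ennreal_mult)
    also have "\<dots> = ennreal D * (\<integral>\<^sup>+x. ennreal (\<bar>v x\<bar> powr ((l - b) * r) * exp (r * lam * (v x)\<^sup>2)) \<partial>lborel)"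
      by (rule nn_integral_cmult) measurable
    also have "\<dots> \<le> ennreal D * ennreal (C * \<delta> powr ((l - b) * r))"
      by (intro mult_left_mono C(2) v \<delta> mod) auto
    also have "\<dots> = ennreal (D * (C * \<delta> powr ((l - b) * r)))"
      using D C by (simp add: ennreal_mult)
    also have "D * (C * \<delta> powr ((l - b) * r)) = (K * \<delta> powr l * m powr b) powr r"
    proof -
      have "b * r + (l - b) * r = l * r" by (simp add: algebra_simps)
      then have "\<delta> powr (b * r) * \<delta> powr ((l - b) * r) = \<delta> powr (l * r)"
        by (simp flip: powr_add)
      then show ?thesis
        using C0 C \<delta> m r by (simp add: D_def K_def powr_mult powr_powr mult_ac)
    qed
    finally show "(\<integral>\<^sup>+x. ennreal (\<bar>f (v x)\<bar> powr r) \<partial>lborel) \<le> ennreal ((K * \<delta> powr l * m powr b) powr r)" .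
  qed
qed

subsection \<open>Time integrals of the heat flow\<close>

text \<open>Supplies an integrable majorant uniform for \<open>z\<close> in a ball. From
  \<open>norm y \<le> dist z y + R\<close> the square of \<open>norm y\<close> is at most twice the
  sum of the squares, and this factor 2 is paid for by doubling the time.\<close>

lemma heat_kernel_dominated:
  fixes y z :: "real^'n"
  assumes t: "t > 0" and z: "norm z \<le> R"
  shows "heat_kernel t z y
    \<le> ((4 * pi * t) powr (- real CARD('n) / 2) / (4 * pi * (2 * t)) powr (- real CARD('n) / 2)
        * exp (R\<^sup>2 / (4 * t))) * heat_kernel (2 * t) 0 y"
proof -
  have "norm y \<le> dist z y + R"
    using norm_triangle_ineq4[of z "z - y"] z by (simp add: dist_norm)
  then have "(norm y)\<^sup>2 \<le> (dist z y + R)\<^sup>2" by (intro power_mono) auto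
  also have "\<dots> \<le> 2 * (dist z y)\<^sup>2 + 2 * R\<^sup>2"
    using sum_squares_ge_zero[of "dist z y - R" 0] by (simp add: power2_eq_square algebra_simps)
  finally have "- (dist z y)\<^sup>2 / (4 * t) \<le> R\<^sup>2 / (4 * t) + - (norm y)\<^sup>2 / (4 * (2 * t))"
    using t by (simp add: field_simps)
  then have "exp (- (dist z y)\<^sup>2 / (4 * t)) \<le> exp (R\<^sup>2 / (4 * t)) * exp (- (norm y)\<^sup>2 / (4 * (2 * t)))"
    unfolding exp_add[symmetric] by simp
  then have "(4 * pi * t) powr (- real CARD('n) / 2) * exp (- (dist z y)\<^sup>2 / (4 * t))
      \<le> (4 * pi * t) powr (- real CARD('n) / 2) * (exp (R\<^sup>2 / (4 * t)) * exp (- (norm y)\<^sup>2 / (4 * (2 * t))))"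
    by (intro mult_left_mono) auto
  also have "\<dots> = ((4 * pi * t) powr (- real CARD('n) / 2) / (4 * pi * (2 * t)) powr (- real CARD('n) / 2)
        * exp (R\<^sup>2 / (4 * t))) * heat_kernel (2 * t) 0 y"
    using t by (simp add: heat_kernel_def)
  finally show ?thesis by (simp add: heat_kernel_def)
qed

lemma abs_le_one_plus_powr:
  fixes x r :: real
  assumes "r \<ge> 1"
  shows "\<bar>x\<bar> \<le> 1 + \<bar>x\<bar> powr r"
proof (cases "\<bar>x\<bar> \<le> 1")
  case False
  then have "\<bar>x\<bar> powr 1 \<le> \<bar>x\<bar> powr r" using assms by (intro powr_mono) auto
  then show ?thesis using False by simp
qed (use powr_ge_zero[of "\<bar>x\<bar>" r] in linarith)

text \<open>Dominated convergence along a convergent, hence bounded, sequence of points. In the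
  majorant \<open>w\<close> the data are bounded by \<open>1 + \<bar>g y\<bar> powr r\<close>: the
  constant is handled by the kernel at doubled time, the power by the uniform kernel bound.\<close>

lemma continuous_on_heat:
  fixes g :: "real^'n \<Rightarrow> real"
  assumes t: "t > 0" and r: "r \<ge> 1" and [measurable]: "g \<in> borel_measurable borel"
    and g: "(\<integral>\<^sup>+y. ennreal (\<bar>g y\<bar> powr r) \<partial>lborel) < \<infinity>"
  shows "continuous_on UNIV (heat t g)"
  unfolding continuous_on_sequentially
proof (intro allI ballI impI, elim conjE)
  fix X and x :: "real^'n"
  assume X: "X \<longlonglongrightarrow> x"
  obtain R where R: "\<And>i. norm (X i) \<le> R"
    using convergent_imp_Bseq[OF convergentI[OF X]] by (auto simp: Bseq_def)
  define c where "c = (4 * pi * t) powr (- real CARD('n) / 2) / (4 * pi * (2 * t)) powr (- real CARD('n) / 2)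
        * exp (R\<^sup>2 / (4 * t))"
  define k where "k = t powr (- real CARD('n) / 2)"
  define w where "w = (\<lambda>y. c * heat_kernel (2 * t) 0 y + k * \<bar>g y\<bar> powr r)"
  have k: "k \<ge> 0" by (simp add: k_def)
  have "integrable lborel (\<lambda>y. \<bar>g y\<bar> powr r)"
    using g by (intro integrableI_nonneg) auto
  then have w: "integrable lborel w"
    unfolding w_def using t by (intro Bochner_Integration.integrable_add integrable_mult_right integrable_heat_kernel) auto
  have "(\<lambda>i. \<integral>y. heat_kernel t (X i) y * g y \<partial>lborel) \<longlonglongrightarrow> (\<integral>y. heat_kernel t x y * g y \<partial>lborel)"
  proof (rule integral_dominated_convergence[OF _ _ w])
    show "AE y in lborel. (\<lambda>i. heat_kernel t (X i) y * g y) \<longlonglongrightarrow> heat_kernel t x y * g y"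
      unfolding heat_kernel_def using t by (intro AE_I2 tendsto_intros X) auto
    fix i
    have "norm (heat_kernel t (X i) y * g y) \<le> w y" for y
    proof -
      have "norm (heat_kernel t (X i) y * g y) \<le> heat_kernel t (X i) y * (1 + \<bar>g y\<bar> powr r)"
        using abs_le_one_plus_powr[OF r, of "g y"] by (simp add: abs_mult mult_left_mono)
      also have "\<dots> = heat_kernel t (X i) y + heat_kernel t (X i) y * \<bar>g y\<bar> powr r"
        by (simp add: algebra_simps)
      also have "\<dots> \<le> w y"
        unfolding w_def c_def k_def
        using heat_kernel_dominated[OF t R] heat_kernel_le[OF t]
        by (intro add_mono mult_right_mono) auto
      finally show ?thesis .
    qed
    then show "AE y in lborel. norm (heat_kernel t (X i) y * g y) \<le> w y" by simp
  qed measurable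
  then show "(heat t g \<circ> X) \<longlonglongrightarrow> heat t g x"
    by (simp add: heat_eq_kernel comp_def)
qed

text \<open>A function that is continuous in the second variable is determined by its values on a
  countable dense set, which can be taken inside the full-measure set where measurability in the
  first variable is known.\<close>
lemma caratheodory_measurable:
  fixes F :: "real \<Rightarrow> 'a::euclidean_space \<Rightarrow> real"
  assumes cont: "\<And>s. continuous_on UNIV (F s)"
    and meas: "AE x in lborel. (\<lambda>s. F s x) \<in> borel_measurable borel"
  shows "(\<lambda>(s, x). F s x) \<in> borel_measurable (borel \<Otimes>\<^sub>M borel)"
proof -
  define A where "A = {x. (\<lambda>s. F s x) \<in> borel_measurable borel}"
  obtain D where D: "countable D" "D \<subseteq> A" "A \<subseteq> closure D" using separable by blast
  \<comment> \<open>A ball missing \<open>A\<close> would be a null set, which is impossible for a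
    nonempty open set. So \<open>A\<close> is dense, and with it the countable set
    \<open>D\<close>.\<close>
  have dense: "\<exists>d\<in>D. dist d x < e" if "e > 0" for x e
  proof -
    have "\<exists>y\<in>A. dist y x < e / 2"
    proof (rule ccontr)
      assume "\<not> ?thesis"
      then have "AE y in lborel. y \<notin> ball x (e / 2)"
        using meas by (auto simp: A_def dist_commute elim!: eventually_mono)
      then have "emeasure lborel (ball x (e / 2)) = 0"
        by (subst (asm) AE_iff_measurable[OF _ refl]) (auto simp: ball_def)
      then have "ball x (e / 2) \<in> null_sets lborel" by (auto intro: null_setsI)
      then have "negligible (ball x (e / 2))"
        by (simp add: negligible_iff_null_sets null_sets_completionI)
      then show False using that open_not_negligible[of "ball x (e / 2)"] by auto
    qed
    then obtain y where y: "y \<in> closure D" "dist y x < e / 2" using D by blast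
    moreover have "e / 2 > 0" using that by simp
    ultimately obtain d where "d \<in> D" "dist d y < e / 2"
      unfolding closure_approachable by blast
    with y show ?thesis by (metis dist_commute dist_triangle_half_r)
  qed
  have ne: "D \<noteq> {}" using dense[of 1 0] by auto
  define d where "d = from_nat_into D"
  have d: "range d = D" unfolding d_def by (rule range_from_nat_into[OF ne D(1)])
  \<comment> \<open>The least index of a point of \<open>D\<close> within \<open>1 / Suc n\<close>
    of \<open>x\<close>. It is measurable with countable range, so evaluating \<open>F\<close> at
    the selected points is jointly measurable and converges to \<open>F\<close> by
    continuity.\<close>
  define \<kappa> where "\<kappa> n x = (LEAST k. dist (d k) x < 1 / real (Suc n))" for n x
  have \<kappa>: "dist (d (\<kappa> n x)) x < 1 / real (Suc n)" for n x
    unfolding \<kappa>_def by (rule LeastI_ex) (use dense[of "1 / real (Suc n)" x] d in auto)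
  have [measurable]: "(\<lambda>s. F s (d k)) \<in> borel_measurable borel" for k
    using d D(2) by (auto simp: A_def)
  show ?thesis
  proof (rule borel_measurable_LIMSEQ_real)
    fix p :: "real \<times> 'a"
    have "(\<lambda>n. d (\<kappa> n (snd p))) \<longlonglongrightarrow> snd p"
    proof (rule metric_LIMSEQ_I)
      fix e :: real assume "e > 0"
      then obtain n0 where n0: "1 / real (Suc n0) < e" by (meson nat_approx_posE)
      have "dist (d (\<kappa> n (snd p))) (snd p) < e" if "n \<ge> n0" for n
      proof -
        have "1 / real (Suc n) \<le> 1 / real (Suc n0)" using that by (simp add: frac_le)
        then show ?thesis using \<kappa>[of n "snd p"] n0 by linarith
      qed
      then show "\<exists>n0. \<forall>n\<ge>n0. dist (d (\<kappa> n (snd p))) (snd p) < e" by blast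
    qed
    then show "(\<lambda>n. F (fst p) (d (\<kappa> n (snd p)))) \<longlonglongrightarrow> (case p of (s, x) \<Rightarrow> F s x)"
      unfolding split_beta
      by (intro continuous_on_tendsto_compose[OF cont]) auto
  next
    fix n
    show "(\<lambda>p. F (fst p) (d (\<kappa> n (snd p)))) \<in> borel_measurable (borel \<Otimes>\<^sub>M borel)"
      unfolding \<kappa>_def
      by (rule measurable_compose_countable[where f="\<lambda>k p. F (fst p) (d k)"]) measurable
  qed
qed

section \<open>Power weights and integral inequalities in time\<close>

lemma nn_integral_powr_from_0:
  fixes c q :: real
  assumes "c \<ge> 0" "q < 1"
  shows "(\<integral>\<^sup>+s. ennreal (s powr (- q)) * indicator {0..c} s \<partial>lborel) = ennreal (c powr (1 - q) / (1 - q))"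
proof -
  have "((\<lambda>s. s powr (- q)) has_integral c powr (- q + 1) / (- q + 1)) {0..c}"
    using assms by (intro has_integral_powr_from_0) auto
  then have "((\<lambda>s. if s \<in> {0..c} then s powr (- q) else 0) has_integral c powr (1 - q) / (1 - q)) UNIV"
    by (subst has_integral_restrict_UNIV) simp
  then have "(\<integral>\<^sup>+s. ennreal (if s \<in> {0..c} then s powr (- q) else 0) \<partial>lborel) = ennreal (c powr (1 - q) / (1 - q))"
    by (intro nn_integral_has_integral_lborel) auto
  then show ?thesis
    by (simp add: indicator_def if_distrib[of ennreal] of_bool_def cong: if_cong)
       (simp add: if_distrib[of "times _"] cong: if_cong)
qed

lemma nn_integral_powr_diff:
  fixes c q t :: real
  assumes "c \<le> t" "q < 1"
  shows "(\<integral>\<^sup>+s. ennreal ((t - s) powr (- q)) * indicator {c..t} s \<partial>lborel) = ennreal ((t - c) powr (1 - q) / (1 - q))"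
proof -
  have "(\<integral>\<^sup>+s. ennreal ((t - s) powr (- q)) * indicator {c..t} s \<partial>lborel)
      = (\<integral>\<^sup>+s. ennreal ((t - (t + (-1) * s)) powr (- q)) * indicator {c..t} (t + (-1) * s) \<partial>lborel)"
    by (subst nn_integral_real_affine[of _ "-1" t]) auto
  also have "\<dots> = (\<integral>\<^sup>+s. ennreal (s powr (- q)) * indicator {0..t - c} s \<partial>lborel)"
    by (intro nn_integral_cong) (auto simp: indicator_def)
  also have "\<dots> = ennreal ((t - c) powr (1 - q) / (1 - q))"
    using assms by (intro nn_integral_powr_from_0) auto
  finally show ?thesis .
qed

text \<open>A bound for the Beta integral. On each half of the interval the nonsingular factor is
  frozen at its worst value, attained at \<open>t / 2\<close>, and the other one is integrated.
  Because \<open>p + q = 1\<close>, all powers of \<open>t\<close> cancel.\<close>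

lemma nn_integral_beta_le:
  fixes p q t :: real
  assumes t: "t > 0" and p: "0 \<le> p" "p < 1" and q: "0 \<le> q" "q < 1" and pq: "p + q = 1"
  shows "(\<integral>\<^sup>+s. ennreal ((t - s) powr (- p) * s powr (- q)) * indicator {0<..<t} s \<partial>lborel)
    \<le> ennreal (1 / (1 - p) + 1 / (1 - q))"
proof -
  have le: "ennreal ((t - s) powr (- p) * s powr (- q)) * indicator {0<..<t} s
      \<le> ennreal ((t/2) powr (-p)) * (ennreal (s powr (-q)) * indicator {0..t/2} s)
       + ennreal ((t/2) powr (-q)) * (ennreal ((t - s) powr (-p)) * indicator {t/2..t} s)" for s
  proof (cases "0 < s \<and> s < t")
    case True
    show ?thesis
    proof (cases "s \<le> t / 2")
      case s: True
      have "(t - s) powr (- p) \<le> (t/2) powr (-p)" using s p t True by (intro powr_mono2') auto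
      then have "ennreal ((t - s) powr (- p) * s powr (- q)) \<le> ennreal ((t/2) powr (-p) * s powr (- q))"
        by (intro ennreal_leI mult_right_mono) auto
      then show ?thesis using s True by (simp add: ennreal_mult add_increasing2)
    next
      case s: False
      have "s powr (- q) \<le> (t/2) powr (-q)" using s q t True by (intro powr_mono2') auto
      then have "ennreal ((t - s) powr (- p) * s powr (- q)) \<le> ennreal ((t/2) powr (-q) * (t - s) powr (- p))"
        by (subst mult.commute, intro ennreal_leI mult_right_mono) auto
      then show ?thesis using s True by (simp add: ennreal_mult)
    qed
  qed auto
  have h: "(t/2) powr (-p) * ((t/2) powr (1 - q) / (1 - q)) = 1 / (1 - q)"
      "(t/2) powr (-q) * ((t - t/2) powr (1 - p) / (1 - p)) = 1 / (1 - p)"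
    using t pq by (simp_all add: field_simps flip: powr_add)
  have "(\<integral>\<^sup>+s. ennreal ((t - s) powr (- p) * s powr (- q)) * indicator {0<..<t} s \<partial>lborel)
     \<le> (\<integral>\<^sup>+s. ennreal ((t/2) powr (-p)) * (ennreal (s powr (-q)) * indicator {0..t/2} s)
       + ennreal ((t/2) powr (-q)) * (ennreal ((t - s) powr (-p)) * indicator {t/2..t} s) \<partial>lborel)"
    by (intro nn_integral_mono le)
  also have "\<dots> = ennreal ((t/2) powr (-p)) * ennreal ((t/2) powr (1 - q) / (1 - q))
      + ennreal ((t/2) powr (-q)) * ennreal ((t - t/2) powr (1 - p) / (1 - p))"
    using t p q by (simp add: nn_integral_add nn_integral_cmult nn_integral_powr_from_0 nn_integral_powr_diff)
  also have "\<dots> = ennreal (1 / (1 - q)) + ennreal (1 / (1 - p))"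
    unfolding h[symmetric] using p q by (subst (1 2) ennreal_mult) auto
  also have "\<dots> = ennreal (1 / (1 - p) + 1 / (1 - q))"
    using p q by (simp add: add.commute flip: ennreal_plus)
  finally show ?thesis .
qed

text \<open>If \<open>\<phi>\<close> is not integrable, the Bochner integral is 0 and the bound is
  trivial. The open interval removes the endpoints, a null set, so that later only times with
  \<open>s > 0\<close> and \<open>t - s > 0\<close> have to be estimated.\<close>

lemma abs_set_integral_le_nn_integral:
  fixes \<phi> :: "real \<Rightarrow> real"
  shows "ennreal \<bar>\<integral>s\<in>{0..t}. \<phi> s \<partial>lborel\<bar> \<le> (\<integral>\<^sup>+s. ennreal \<bar>\<phi> s\<bar> * indicator {0<..<t} s \<partial>lborel)"
proof (cases "set_integrable lborel {0..t} \<phi>")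
  case True
  then have "ennreal \<bar>\<integral>s\<in>{0..t}. \<phi> s \<partial>lborel\<bar> \<le> (\<integral>\<^sup>+s. norm (indicator {0..t} s *\<^sub>R \<phi> s) \<partial>lborel)"
    using integral_norm_bound_ennreal[of lborel "\<lambda>s. indicator {0..t} s *\<^sub>R \<phi> s"]
    unfolding set_lebesgue_integral_def set_integrable_def by simp
  also have "\<dots> = (\<integral>\<^sup>+s. ennreal \<bar>\<phi> s\<bar> * indicator {0<..<t} s \<partial>lborel)"
  proof (rule nn_integral_cong_AE)
    have "AE s in lborel. s \<noteq> 0 \<and> s \<noteq> t"
      using AE_lborel_singleton[of 0] AE_lborel_singleton[of t] by eventually_elim auto
    then show "AE s in lborel. ennreal (norm (indicator {0..t} s *\<^sub>R \<phi> s)) = ennreal \<bar>\<phi> s\<bar> * indicator {0<..<t} s"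
      by eventually_elim (auto simp: indicator_def)
  qed
  finally show ?thesis .
next
  case False
  then show ?thesis
    by (simp add: set_lebesgue_integral_def set_integrable_def not_integrable_integral_eq)
qed

text \<open>Minkowski's integral inequality in L^2 through a weighted Cauchy-Schwarz inequality: the
  squared time integral is at most the integral of \<open>H\<close> times that of
  \<open>F^2 / H\<close>. After exchanging integrals, the bound on \<open>F\<close> leaves the
  integral of \<open>H\<close> once more.\<close>

lemma minkowski_L2:
  fixes F :: "real \<Rightarrow> 'a::euclidean_space \<Rightarrow> real" and H :: "real \<Rightarrow> real"
  assumes [measurable]: "(\<lambda>(s, x). F s x) \<in> borel_measurable (borel \<Otimes>\<^sub>M borel)"
      "H \<in> borel_measurable borel" "S \<in> sets borel"
    and pos: "\<And>s. s \<in> S \<Longrightarrow> H s > 0"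
    and B: "(\<integral>\<^sup>+s. ennreal (H s) * indicator S s \<partial>lborel) \<le> ennreal B" and B0: "B \<ge> 0"
    and F: "\<And>s. s \<in> S \<Longrightarrow> (\<integral>\<^sup>+x. ennreal ((F s x)\<^sup>2) \<partial>lborel) \<le> ennreal ((H s)\<^sup>2)"
  shows "(\<integral>\<^sup>+x. (\<integral>\<^sup>+s. ennreal \<bar>F s x\<bar> * indicator S s \<partial>lborel)\<^sup>2 \<partial>lborel) \<le> ennreal (B\<^sup>2)"
proof -
  define G where "G s x = ennreal ((F s x)\<^sup>2 / H s) * indicator S s" for s x
  have [measurable]: "(\<lambda>(s, x). G s x) \<in> borel_measurable (borel \<Otimes>\<^sub>M borel)"
    unfolding G_def split_beta by measurable
  have [measurable]: "(\<lambda>s. F s x) \<in> borel_measurable borel" for x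
    using measurable_compose[OF measurable_Pair2'[of x borel borel] assms(1)] by simp
  have [measurable]: "(\<lambda>x. F s x) \<in> borel_measurable borel" for s
    using measurable_compose[OF measurable_Pair1'[of s borel borel] assms(1)] by simp
  have cs: "(\<integral>\<^sup>+s. ennreal \<bar>F s x\<bar> * indicator S s \<partial>lborel)\<^sup>2
      \<le> ennreal B * (\<integral>\<^sup>+s. G s x \<partial>lborel)" for x
  proof -
    have "(\<integral>\<^sup>+s. ennreal \<bar>F s x\<bar> * indicator S s \<partial>lborel)
       = (\<integral>\<^sup>+s. (ennreal (sqrt (H s)) * indicator S s) * (ennreal (\<bar>F s x\<bar> / sqrt (H s)) * indicator S s) \<partial>lborel)"
    proof (intro nn_integral_cong)
      fix s
      show "ennreal \<bar>F s x\<bar> * indicator S s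
         = (ennreal (sqrt (H s)) * indicator S s) * (ennreal (\<bar>F s x\<bar> / sqrt (H s)) * indicator S s)"
        using pos[of s] by (cases "s \<in> S") (auto simp flip: ennreal_mult)
    qed
    then have "(\<integral>\<^sup>+s. ennreal \<bar>F s x\<bar> * indicator S s \<partial>lborel)\<^sup>2
       \<le> (\<integral>\<^sup>+s. (ennreal (sqrt (H s)) * indicator S s)\<^sup>2 \<partial>lborel)
         * (\<integral>\<^sup>+s. (ennreal (\<bar>F s x\<bar> / sqrt (H s)) * indicator S s)\<^sup>2 \<partial>lborel)"
      by (simp only:) (rule Cauchy_Schwarz_nn_integral; measurable)
    also have "(\<integral>\<^sup>+s. (ennreal (sqrt (H s)) * indicator S s)\<^sup>2 \<partial>lborel)
        = (\<integral>\<^sup>+s. ennreal (H s) * indicator S s \<partial>lborel)"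
    proof (intro nn_integral_cong)
      fix s
      show "(ennreal (sqrt (H s)) * indicator S s)\<^sup>2 = ennreal (H s) * indicator S s"
        using pos[of s] by (cases "s \<in> S") (auto simp: ennreal_power)
    qed
    also have "(\<integral>\<^sup>+s. (ennreal (\<bar>F s x\<bar> / sqrt (H s)) * indicator S s)\<^sup>2 \<partial>lborel) = (\<integral>\<^sup>+s. G s x \<partial>lborel)"
    proof (intro nn_integral_cong)
      fix s
      show "(ennreal (\<bar>F s x\<bar> / sqrt (H s)) * indicator S s)\<^sup>2 = G s x"
        using pos[of s] by (cases "s \<in> S") (auto simp: G_def ennreal_power power_divide)
    qed
    also have "(\<integral>\<^sup>+s. ennreal (H s) * indicator S s \<partial>lborel) * (\<integral>\<^sup>+s. G s x \<partial>lborel) \<le> ennreal B * (\<integral>\<^sup>+s. G s x \<partial>lborel)"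
      by (intro mult_right_mono B) auto
    finally show ?thesis .
  qed
  have "(\<integral>\<^sup>+x. (\<integral>\<^sup>+s. ennreal \<bar>F s x\<bar> * indicator S s \<partial>lborel)\<^sup>2 \<partial>lborel)
     \<le> (\<integral>\<^sup>+x. ennreal B * (\<integral>\<^sup>+s. G s x \<partial>lborel) \<partial>lborel)"
    by (intro nn_integral_mono cs)
  also have "\<dots> = ennreal B * (\<integral>\<^sup>+x. (\<integral>\<^sup>+s. G s x \<partial>lborel) \<partial>lborel)"
    by (rule nn_integral_cmult) measurable
  also have "(\<integral>\<^sup>+x. (\<integral>\<^sup>+s. G s x \<partial>lborel) \<partial>lborel) = (\<integral>\<^sup>+s. (\<integral>\<^sup>+x. G s x \<partial>lborel) \<partial>lborel)"
    by (rule lborel_pair.Fubini'[symmetric]) measurable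
  also have "\<dots> \<le> (\<integral>\<^sup>+s. ennreal (H s) * indicator S s \<partial>lborel)"
  proof (intro nn_integral_mono)
    fix s
    show "(\<integral>\<^sup>+x. G s x \<partial>lborel) \<le> ennreal (H s) * indicator S s"
    proof (cases "s \<in> S")
      case True
      have "(\<integral>\<^sup>+x. G s x \<partial>lborel) = (\<integral>\<^sup>+x. ennreal (1 / H s) * ennreal ((F s x)\<^sup>2) \<partial>lborel)"
        using True pos[OF True] by (simp add: G_def flip: ennreal_mult)
      also have "\<dots> = ennreal (1 / H s) * (\<integral>\<^sup>+x. ennreal ((F s x)\<^sup>2) \<partial>lborel)"
        by (rule nn_integral_cmult) measurable
      also have "\<dots> \<le> ennreal (1 / H s) * ennreal ((H s)\<^sup>2)"
        by (intro mult_left_mono F True) auto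
      also have "\<dots> = ennreal (H s)"
        using pos[OF True] by (simp add: power2_eq_square flip: ennreal_mult)
      finally show ?thesis using True by simp
    qed (simp add: G_def)
  qed
  also have "\<dots> \<le> ennreal B" by (rule B)
  also have "ennreal B * ennreal B = ennreal (B\<^sup>2)"
    using B0 by (simp add: power2_eq_square ennreal_mult)
  finally show ?thesis by (simp add: mult_left_mono)
qed

subsection \<open>Duhamel term\<close>

text \<open>The L^r bound on \<open>f (v y)\<close> followed by L^r to L^infinity smoothing. The
  pair \<open>(r, b)\<close> distributes the singularity between \<open>t - s\<close> and
  \<open>s\<close> in the Duhamel integrals.\<close>

lemma heat_nonlinearity_sup:
  fixes f :: "real \<Rightarrow> real" and l b r C0 lam :: real
  assumes C0: "C0 > 0" and fb: "\<And>v. \<bar>f v\<bar> \<le> C0 * \<bar>v\<bar> powr l * exp (lam * v\<^sup>2)"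
    and [measurable]: "f \<in> borel_measurable borel"
    and r: "r \<ge> 1" and b: "b \<ge> 0" and lbr: "(l - b) * r \<ge> 2"
  obtains K where "K > 0"
    "\<And>(v::real^'n \<Rightarrow> real) \<delta> m \<tau> x. \<lbrakk>v \<in> borel_measurable borel; \<delta> > 0; r * lam * \<delta>\<^sup>2 \<le> 1 / 2;
       orlicz_mod v \<delta> \<le> 1; m > 0; b = 0 \<or> (AE x in lborel. \<bar>v x\<bar> \<le> \<delta> * m); \<tau> > 0\<rbrakk>
      \<Longrightarrow> \<bar>heat \<tau> (\<lambda>y. f (v y)) x\<bar> \<le> \<tau> powr (- real CARD('n) / (2 * r)) * (K * \<delta> powr l * m powr b)"
proof -
  have r0: "r > 0" using r by simp
  from nonlinearity_Lr[OF C0 fb r0 b lbr, where 'n='n] obtain K where K: "K > 0"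
    "\<And>(v::real^'n \<Rightarrow> real) \<delta> m. \<lbrakk>v \<in> borel_measurable borel; \<delta> > 0; r * lam * \<delta>\<^sup>2 \<le> 1 / 2;
       orlicz_mod v \<delta> \<le> 1; m > 0; b = 0 \<or> (AE x in lborel. \<bar>v x\<bar> \<le> \<delta> * m)\<rbrakk>
      \<Longrightarrow> (\<integral>\<^sup>+x. ennreal (\<bar>f (v x)\<bar> powr r) \<partial>lborel) \<le> ennreal ((K * \<delta> powr l * m powr b) powr r)"
    by blast
  show ?thesis
  proof (rule that[OF K(1)])
    fix v :: "real^'n \<Rightarrow> real" and \<delta> m \<tau> :: real and x
    assume v: "v \<in> borel_measurable borel" "\<delta> > 0" "r * lam * \<delta>\<^sup>2 \<le> 1 / 2"
       "orlicz_mod v \<delta> \<le> 1" "m > 0" "b = 0 \<or> (AE x in lborel. \<bar>v x\<bar> \<le> \<delta> * m)" and \<tau>: "\<tau> > 0"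
    note [measurable] = v(1)
    show "\<bar>heat \<tau> (\<lambda>y. f (v y)) x\<bar> \<le> \<tau> powr (- real CARD('n) / (2 * r)) * (K * \<delta> powr l * m powr b)"
      using K(1) by (intro heat_sup_le[OF \<tau> r] K(2)[OF v]) auto
  qed
qed

text \<open>\<open>T\<close> is the time up to which the supremum bound is known. The integral is
  cut into early times \<open>s \<le> t / 2\<close>, late times up to \<open>T\<close>, and the tail
  after \<open>T\<close>, with a different pair \<open>(r, b)\<close> on each. The first two scale
  like \<open>t powr (- a)\<close>; the tail costs \<open>sqrt (t - T)\<close>.\<close>

lemma duhamel_decay:
  fixes f :: "real \<Rightarrow> real" and l C0 lam a :: real
  assumes C0: "C0 > 0" and fb: "\<And>v. \<bar>f v\<bar> \<le> C0 * \<bar>v\<bar> powr l * exp (lam * v\<^sup>2)"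
    and f [measurable]: "f \<in> borel_measurable borel"
    and l: "l \<ge> 2" and nl: "real CARD('n) * (l - 1) \<ge> 4" and lam: "lam > 0"
    and a_def: "a = 1 / (l - 1)"
  obtains K where "K > 0"
    "\<And>(u :: real \<Rightarrow> real^'n \<Rightarrow> real) \<delta> t T x. \<lbrakk>\<delta> > 0; real CARD('n) * l * lam * \<delta>\<^sup>2 \<le> 1 / 2; t > 0; 0 \<le> T; T \<le> t;
       \<And>s. 0 < s \<Longrightarrow> s < t \<Longrightarrow> u s \<in> borel_measurable borel \<and> orlicz_mod (u s) \<delta> \<le> 1;
       \<And>s. 0 < s \<Longrightarrow> s \<le> T \<Longrightarrow> AE x in lborel. \<bar>u s x\<bar> \<le> \<delta> * s powr (- a)\<rbrakk>
     \<Longrightarrow> \<bar>\<integral>s\<in>{0..t}. heat (t - s) (\<lambda>y. f (u s y)) x \<partial>lborel\<bar> \<le> K * \<delta> powr l * (t powr (- a) + sqrt (t - T))"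
proof -
  define n where "n = real CARD('n)"
  have n1: "n \<ge> 1" by (simp add: n_def Suc_leI)
  have a: "0 < a" "a \<le> 1" "a * (l - 1) = 1" using l by (auto simp: a_def)
  have n4: "4 * a \<le> n" using nl l by (simp add: a_def n_def field_simps)
  have l': "l = 1 + 1 / a" using l by (simp add: a_def)
  have ex: "- real CARD('n) / (2 * (n / (4 * a))) = - (2 * a)" "- real CARD('n) / (2 * n) = - (1 / 2)"
    using a n1 by (auto simp: n_def)
  \<comment> \<open>\<open>n * l\<close> dominates both Lebesgue exponents used here, so a single
    smallness condition on \<open>\<delta>\<close> serves all three estimates.\<close>
  have n4l: "n / (4 * a) \<le> n * l"
  proof -
    have "1 / (4 * a) \<le> l" using a by (simp add: l' field_simps)
    then show ?thesis using mult_left_mono[of "1 / (4 * a)" l n] n1 by simp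
  qed
  have nnl: "n \<le> n * l" using l n1 by simp
  \<comment> \<open>Early times, \<open>b = l - 2\<close>: the weight becomes
    \<open>s powr (- (1 - a))\<close>, integrable at 0, and the singularity
    \<open>(t - s) powr (- (2 * a))\<close> is harmless for \<open>s \<le> t / 2\<close>.\<close>
  have e1: "(l - (l - 2)) * (n / (4 * a)) \<ge> 2" using n4 a by (simp add: field_simps)
  from heat_nonlinearity_sup[OF C0 fb f _ _ e1, where 'n='n] l a n4
  obtain K1 where K1: "K1 > 0"
    "\<And>(v::real^'n \<Rightarrow> real) \<delta> m \<tau> x. \<lbrakk>v \<in> borel_measurable borel; \<delta> > 0; n / (4 * a) * lam * \<delta>\<^sup>2 \<le> 1 / 2;
       orlicz_mod v \<delta> \<le> 1; m > 0; l - 2 = 0 \<or> (AE x in lborel. \<bar>v x\<bar> \<le> \<delta> * m); \<tau> > 0\<rbrakk>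
      \<Longrightarrow> \<bar>heat \<tau> (\<lambda>y. f (v y)) x\<bar> \<le> \<tau> powr (- (2 * a)) * (K1 * \<delta> powr l * m powr (l - 2))"
    unfolding ex by (auto simp: field_simps)
  \<comment> \<open>Late times, \<open>r = n\<close>: the weight
    \<open>(t - s) powr (- (1 / 2))\<close> is integrable at \<open>t\<close>, while
    \<open>s powr (- (a + 1 / 2))\<close> is harmless for \<open>s > t / 2\<close>.\<close>
  have e2: "(l - (l + 1) / 2) * n \<ge> 2" using nl by (simp add: n_def field_simps)
  from heat_nonlinearity_sup[OF C0 fb f n1 _ e2, where 'n='n] l
  obtain K2 where K2: "K2 > 0"
    "\<And>(v::real^'n \<Rightarrow> real) \<delta> m \<tau> x. \<lbrakk>v \<in> borel_measurable borel; \<delta> > 0; n * lam * \<delta>\<^sup>2 \<le> 1 / 2;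
       orlicz_mod v \<delta> \<le> 1; m > 0; (l + 1) / 2 = 0 \<or> (AE x in lborel. \<bar>v x\<bar> \<le> \<delta> * m); \<tau> > 0\<rbrakk>
      \<Longrightarrow> \<bar>heat \<tau> (\<lambda>y. f (v y)) x\<bar> \<le> \<tau> powr (- (1 / 2)) * (K2 * \<delta> powr l * m powr ((l + 1) / 2))"
    unfolding ex by auto
  \<comment> \<open>The tail, \<open>b = 0\<close>: only the Luxemburg bound enters.\<close>
  have e3: "(l - 0) * n \<ge> 2" using l n1 mult_mono[of 2 l 1 n] by simp
  from heat_nonlinearity_sup[OF C0 fb f n1 _ e3, where 'n='n]
  obtain K3 where K3: "K3 > 0"
    "\<And>(v::real^'n \<Rightarrow> real) \<delta> m \<tau> x. \<lbrakk>v \<in> borel_measurable borel; \<delta> > 0; n * lam * \<delta>\<^sup>2 \<le> 1 / 2;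
       orlicz_mod v \<delta> \<le> 1; m > 0; 0 = (0::real) \<or> (AE x in lborel. \<bar>v x\<bar> \<le> \<delta> * m); \<tau> > 0\<rbrakk>
      \<Longrightarrow> \<bar>heat \<tau> (\<lambda>y. f (v y)) x\<bar> \<le> \<tau> powr (- (1 / 2)) * (K3 * \<delta> powr l * m powr 0)"
    unfolding ex by auto
  \<comment> \<open>The outer factor 2 absorbs \<open>2 powr a\<close>, which arises from
    \<open>t / 2\<close>; the coefficients 2 at \<open>K2\<close> and \<open>K3\<close> come from
    integrating an inverse square root.\<close>
  define K where "K = 2 * (K1 / a + 2 * K2) + 2 * K3"
  show ?thesis
  proof (rule that[of K])
    show "K > 0" using K1(1) K2(1) K3(1) a by (simp add: K_def add_pos_pos)
    fix u :: "real \<Rightarrow> real^'n \<Rightarrow> real" and \<delta> t T x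
    assume \<delta>: "\<delta> > 0" and \<delta>s: "real CARD('n) * l * lam * \<delta>\<^sup>2 \<le> 1 / 2" and t: "t > 0"
      and T: "0 \<le> T" "T \<le> t"
      and mod: "\<And>s. 0 < s \<Longrightarrow> s < t \<Longrightarrow> u s \<in> borel_measurable borel \<and> orlicz_mod (u s) \<delta> \<le> 1"
      and bd: "\<And>s. 0 < s \<Longrightarrow> s \<le> T \<Longrightarrow> AE x in lborel. \<bar>u s x\<bar> \<le> \<delta> * s powr (- a)"
    have "r * lam * \<delta>\<^sup>2 \<le> 1 / 2" if "r \<le> n * l" for r
    proof -
      have "r * (lam * \<delta>\<^sup>2) \<le> n * l * (lam * \<delta>\<^sup>2)" using lam by (intro mult_right_mono that) auto
      also have "\<dots> \<le> 1 / 2" using \<delta>s by (simp add: n_def mult.assoc)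
      finally show ?thesis by (simp only: mult.assoc)
    qed
    with n4l nnl have sm: "n / (4 * a) * lam * \<delta>\<^sup>2 \<le> 1 / 2" "n * lam * \<delta>\<^sup>2 \<le> 1 / 2"
      by blast+
    define A1 where "A1 = K1 * \<delta> powr l * (t/2) powr (- (2 * a))"
    define A2 where "A2 = K2 * \<delta> powr l * (t/2) powr (- (a + 1/2))"
    define A3 where "A3 = K3 * \<delta> powr l"
    have A: "A1 \<ge> 0" "A2 \<ge> 0" "A3 \<ge> 0" using K1(1) K2(1) K3(1) by (auto simp: A1_def A2_def A3_def)
    \<comment> \<open>Each majorant lives on the whole interval over which its weight is integrable.
      The intervals may overlap, so their sum dominates the integrand at every time.\<close>
    define W1 where "W1 s = ennreal A1 * (ennreal (s powr (- (1 - a))) * indicator {0..t/2} s)" for s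
    define W2 where "W2 s = ennreal A2 * (ennreal ((t - s) powr (- (1/2))) * indicator {t/2..t} s)" for s
    define W3 where "W3 s = ennreal A3 * (ennreal ((t - s) powr (- (1/2))) * indicator {T..t} s)" for s
    have le: "ennreal \<bar>heat (t - s) (\<lambda>y. f (u s y)) x\<bar> * indicator {0<..<t} s \<le> W1 s + W2 s + W3 s" for s
    proof (cases "0 < s \<and> s < t")
      case True
      then have s: "0 < s" "s < t" by auto
      let ?h = "\<bar>heat (t - s) (\<lambda>y. f (u s y)) x\<bar>"
      have us: "u s \<in> borel_measurable borel" "orlicz_mod (u s) \<delta> \<le> 1" using mod[OF s] by auto
      have sa: "s powr (- a) > 0" using s by simp
      consider "s > T" | "s \<le> T" "s \<le> t / 2" | "s \<le> T" "s > t / 2" by linarith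
      then have "ennreal ?h \<le> W1 s + W2 s + W3 s"
      proof cases
        case 1
        have "?h \<le> (t - s) powr (- (1 / 2)) * (K3 * \<delta> powr l * 1 powr 0)"
          using s by (intro K3(2) us \<delta> sm) auto
        also have "\<dots> = A3 * (t - s) powr (- (1/2))" by (simp add: A3_def)
        finally have "ennreal ?h \<le> W3 s"
          using 1 s A by (simp add: W3_def ennreal_leI flip: ennreal_mult)
        then show ?thesis by (simp add: add_increasing)
      next
        case 2
        have "?h \<le> (t - s) powr (- (2 * a)) * (K1 * \<delta> powr l * (s powr (- a)) powr (l - 2))"
          using s 2 by (intro K1(2) us \<delta> sm bd disjI2) auto
        also have "(s powr (- a)) powr (l - 2) = s powr (- (1 - a))"
          using a by (simp add: powr_powr algebra_simps)
        also have "(t - s) powr (- (2 * a)) * (K1 * \<delta> powr l * s powr (- (1 - a)))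
            \<le> (t/2) powr (- (2 * a)) * (K1 * \<delta> powr l * s powr (- (1 - a)))"
          using K1(1) a t s 2 by (intro mult_right_mono powr_mono2') auto
        also have "\<dots> = A1 * s powr (- (1 - a))" by (simp add: A1_def)
        finally have "ennreal ?h \<le> W1 s"
          using 2 s A by (simp add: W1_def ennreal_leI flip: ennreal_mult)
        then show ?thesis by (simp add: add_increasing2)
      next
        case 3
        have "?h \<le> (t - s) powr (- (1 / 2)) * (K2 * \<delta> powr l * (s powr (- a)) powr ((l + 1) / 2))"
          using s 3 by (intro K2(2) us \<delta> sm bd disjI2) auto
        also have "(s powr (- a)) powr ((l + 1) / 2) = s powr (- (a + 1/2))"
        proof -
          have "- a * ((l + 1) / 2) = - (a + 1/2)" using a by (simp add: field_simps)
          then show ?thesis by (simp only: powr_powr)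
        qed
        also have "(t - s) powr (- (1 / 2)) * (K2 * \<delta> powr l * s powr (- (a + 1/2)))
            \<le> (t - s) powr (- (1 / 2)) * (K2 * \<delta> powr l * (t/2) powr (- (a + 1/2)))"
          using K2(1) a t s 3 by (intro mult_left_mono powr_mono2') auto
        also have "\<dots> = A2 * (t - s) powr (- (1/2))" by (simp add: A2_def)
        finally have "ennreal ?h \<le> W2 s"
          using 3 s A by (simp add: W2_def ennreal_leI flip: ennreal_mult)
        then show ?thesis by (simp add: add_increasing add_increasing2)
      qed
      then show ?thesis using s by simp
    qed auto
    have "ennreal \<bar>\<integral>s\<in>{0..t}. heat (t - s) (\<lambda>y. f (u s y)) x \<partial>lborel\<bar>
       \<le> (\<integral>\<^sup>+s. ennreal \<bar>heat (t - s) (\<lambda>y. f (u s y)) x\<bar> * indicator {0<..<t} s \<partial>lborel)"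
      by (rule abs_set_integral_le_nn_integral)
    also have "\<dots> \<le> (\<integral>\<^sup>+s. W1 s + W2 s + W3 s \<partial>lborel)"
      by (intro nn_integral_mono le)
    also have "\<dots> = (\<integral>\<^sup>+s. W1 s \<partial>lborel) + (\<integral>\<^sup>+s. W2 s \<partial>lborel) + (\<integral>\<^sup>+s. W3 s \<partial>lborel)"
      unfolding W1_def W2_def W3_def by (simp add: nn_integral_add)
    also have "\<dots> = ennreal A1 * ennreal ((t/2) powr a / a) + ennreal A2 * ennreal ((t/2) powr (1/2) / (1/2))
        + ennreal A3 * ennreal ((t - T) powr (1/2) / (1/2))"
    proof -
      have "(\<integral>\<^sup>+s. W1 s \<partial>lborel) = ennreal A1 * ennreal ((t/2) powr (1 - (1 - a)) / (1 - (1 - a)))"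
        unfolding W1_def using a t by (subst nn_integral_cmult, measurable, subst nn_integral_powr_from_0) auto
      moreover have "(\<integral>\<^sup>+s. W2 s \<partial>lborel) = ennreal A2 * ennreal ((t - t/2) powr (1 - 1/2) / (1 - 1/2))"
        unfolding W2_def using t by (subst nn_integral_cmult, measurable, subst nn_integral_powr_diff) auto
      moreover have "(\<integral>\<^sup>+s. W3 s \<partial>lborel) = ennreal A3 * ennreal ((t - T) powr (1 - 1/2) / (1 - 1/2))"
        unfolding W3_def using T by (subst nn_integral_cmult, measurable, subst nn_integral_powr_diff) auto
      ultimately show ?thesis by simp
    qed
    also have "\<dots> = ennreal (A1 * ((t/2) powr a / a) + A2 * ((t/2) powr (1/2) / (1/2)) + A3 * ((t - T) powr (1/2) / (1/2)))"
    proof -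
      have "ennreal b1 * ennreal c1 + ennreal b2 * ennreal c2 + ennreal b3 * ennreal c3
          = ennreal (b1 * c1 + b2 * c2 + b3 * c3)"
        if "b1 \<ge> 0" "c1 \<ge> 0" "b2 \<ge> 0" "c2 \<ge> 0" "b3 \<ge> 0" "c3 \<ge> 0" for b1 c1 b2 c2 b3 c3
        using that by (simp add: ennreal_mult)
      then show ?thesis using A a by simp
    qed
    finally have main: "\<bar>\<integral>s\<in>{0..t}. heat (t - s) (\<lambda>y. f (u s y)) x \<partial>lborel\<bar>
       \<le> A1 * ((t/2) powr a / a) + A2 * ((t/2) powr (1/2) / (1/2)) + A3 * ((t - T) powr (1/2) / (1/2))"
      using A a by (subst (asm) ennreal_le_iff) auto
    have "A1 * ((t/2) powr a / a) = \<delta> powr l * (K1 / a * (t/2) powr (- a))"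
    proof -
      have "(t/2) powr (- (2 * a)) * (t/2) powr a = (t/2) powr (- a)" by (simp flip: powr_add)
      then show ?thesis by (simp add: A1_def)
    qed
    moreover have "A2 * ((t/2) powr (1/2) / (1/2)) = \<delta> powr l * (2 * K2 * (t/2) powr (- a))"
    proof -
      have "(t/2) powr (- (a + 1/2)) * (t/2) powr (1/2) = (t/2) powr (- a)" by (simp flip: powr_add)
      then show ?thesis by (simp add: A2_def)
    qed
    moreover have "A3 * ((t - T) powr (1/2) / (1/2)) = \<delta> powr l * (2 * K3 * sqrt (t - T))"
      using T by (simp add: A3_def powr_half_sqrt)
    ultimately have eq: "A1 * ((t/2) powr a / a) + A2 * ((t/2) powr (1/2) / (1/2)) + A3 * ((t - T) powr (1/2) / (1/2))
        = \<delta> powr l * ((K1 / a + 2 * K2) * (t/2) powr (- a) + 2 * K3 * sqrt (t - T))"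
      by (simp only: distrib_left distrib_right add.assoc mult_ac)
    have "(t/2) powr (- a) = 2 powr a * t powr (- a)"
      using t by (simp add: powr_divide powr_minus field_simps)
    also have "\<dots> \<le> 2 powr 1 * t powr (- a)"
      using a by (intro mult_right_mono powr_mono) auto
    finally have "(K1 / a + 2 * K2) * (t/2) powr (- a) + 2 * K3 * sqrt (t - T)
        \<le> (K1 / a + 2 * K2) * (2 * t powr (- a)) + 2 * K3 * sqrt (t - T)"
      using K1(1) K2(1) a by (intro add_right_mono mult_left_mono) auto
    also have "\<dots> \<le> K * t powr (- a) + K * sqrt (t - T)"
      using K1(1) K2(1) K3(1) a T unfolding K_def
      by (intro add_mono) (auto simp: algebra_simps intro!: add_nonneg_nonneg)
    finally have "\<delta> powr l * ((K1 / a + 2 * K2) * (t/2) powr (- a) + 2 * K3 * sqrt (t - T))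
        \<le> \<delta> powr l * (K * t powr (- a) + K * sqrt (t - T))"
      by (intro mult_left_mono) auto
    with main eq show "\<bar>\<integral>s\<in>{0..t}. heat (t - s) (\<lambda>y. f (u s y)) x \<partial>lborel\<bar> \<le> K * \<delta> powr l * (t powr (- a) + sqrt (t - T))"
      by (simp add: algebra_simps)
  qed
qed

text \<open>The embedding \<open>orlicz_mod_le_of_bounded\<close> reduces this to a supremum and an
  L^2 bound by the same \<open>A\<close>. In both, the exponents of \<open>t - s\<close> and
  \<open>s\<close> are made to add up to 1, so the time integrals are bounded independently of
  \<open>t\<close>.\<close>

lemma duhamel_orlicz:
  fixes f :: "real \<Rightarrow> real" and l C0 lam a :: real
  assumes C0: "C0 > 0" and fb: "\<And>v. \<bar>f v\<bar> \<le> C0 * \<bar>v\<bar> powr l * exp (lam * v\<^sup>2)"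
    and f [measurable]: "f \<in> borel_measurable borel"
    and l: "l \<ge> 2" and nl: "real CARD('n) * (l - 1) \<ge> 4" and lam: "lam > 0"
    and a_def: "a = 1 / (l - 1)"
  obtains K where "K > 0"
    "\<And>(u :: real \<Rightarrow> real^'n \<Rightarrow> real) \<delta> t w. \<lbrakk>\<delta> > 0; real CARD('n) * l * lam * \<delta>\<^sup>2 \<le> 1 / 2; t > 0;
       \<And>s. 0 < s \<Longrightarrow> s < t \<Longrightarrow> u s \<in> borel_measurable borel \<and> orlicz_mod (u s) \<delta> \<le> 1;
       \<And>s. 0 < s \<Longrightarrow> s < t \<Longrightarrow> AE x in lborel. \<bar>u s x\<bar> \<le> \<delta> * s powr (- a);
       w \<in> borel_measurable borel;
       AE x in lborel. set_integrable lborel {0..t} (\<lambda>s. heat (t - s) (\<lambda>y. f (u s y)) x) \<and>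
         w x = (\<integral>s\<in>{0..t}. heat (t - s) (\<lambda>y. f (u s y)) x \<partial>lborel)\<rbrakk>
     \<Longrightarrow> orlicz_mod w (K * \<delta> powr l) \<le> 1"
proof -
  define n where "n = real CARD('n)"
  \<comment> \<open>Chosen so that smoothing from \<open>L^\<rho>\<close> to L^2 costs the power
    \<open>- 1 / 4\<close> of time in every dimension.\<close>
  define \<rho> where "\<rho> = 2 * n / (n + 1)"
  have n1: "n \<ge> 1" by (simp add: n_def Suc_leI)
  have a: "0 < a" "a \<le> 1" "a * (l - 1) = 1" using l by (auto simp: a_def)
  have \<rho>: "1 \<le> \<rho>" "\<rho> \<le> 2" "\<rho> > 0" "\<rho> \<le> n" using n1 mult_right_mono[of 1 n n] by (auto simp: \<rho>_def field_simps)
  have nnl: "n \<le> n * l" using l n1 by simp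
  have ex: "- real CARD('n) / (2 * n) = - (1 / 2)" "- real CARD('n) / 2 * (1 / \<rho> - 1 / 2) = - (1 / 4)"
    using n1 unfolding n_def[symmetric] by (auto simp: \<rho>_def field_simps)
  have e1: "(l - (l - 1) / 2) * n \<ge> 2"
  proof -
    have "(l - (l - 1) / 2) * n = n * (l - 1) / 2 + n" by (simp add: field_simps)
    then show ?thesis using nl n1 by (simp add: n_def)
  qed
  from heat_nonlinearity_sup[OF C0 fb f n1 _ e1, where 'n='n] l
  obtain K1 where K1: "K1 > 0"
    "\<And>(v::real^'n \<Rightarrow> real) \<delta> m \<tau> x. \<lbrakk>v \<in> borel_measurable borel; \<delta> > 0; n * lam * \<delta>\<^sup>2 \<le> 1 / 2;
       orlicz_mod v \<delta> \<le> 1; m > 0; (l - 1) / 2 = 0 \<or> (AE x in lborel. \<bar>v x\<bar> \<le> \<delta> * m); \<tau> > 0\<rbrakk>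
      \<Longrightarrow> \<bar>heat \<tau> (\<lambda>y. f (v y)) x\<bar> \<le> \<tau> powr (- (1 / 2)) * (K1 * \<delta> powr l * m powr ((l - 1) / 2))"
    unfolding ex by auto
  \<comment> \<open>The left side is \<open>(n * (l - 1) + 4 * n) / (2 * (n + 1))\<close>, so the
    condition amounts exactly to \<open>n * (l - 1) \<ge> 4\<close>.\<close>
  have e2: "(l - 3 / 4 * (l - 1)) * \<rho> \<ge> 2"
    using nl n1 by (simp add: \<rho>_def n_def field_simps)
  from nonlinearity_Lr[OF C0 fb \<rho>(3) _ e2, where 'n='n] l
  obtain K2 where K2: "K2 > 0"
    "\<And>(v::real^'n \<Rightarrow> real) \<delta> m. \<lbrakk>v \<in> borel_measurable borel; \<delta> > 0; \<rho> * lam * \<delta>\<^sup>2 \<le> 1 / 2;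
       orlicz_mod v \<delta> \<le> 1; m > 0; 3 / 4 * (l - 1) = 0 \<or> (AE x in lborel. \<bar>v x\<bar> \<le> \<delta> * m)\<rbrakk>
      \<Longrightarrow> (\<integral>\<^sup>+x. ennreal (\<bar>f (v x)\<bar> powr \<rho>) \<partial>lborel) \<le> ennreal ((K2 * \<delta> powr l * m powr (3 / 4 * (l - 1))) powr \<rho>)"
    by auto
  \<comment> \<open>The Beta bounds are \<open>2 + 2 = 4\<close> for the supremum and
    \<open>4 / 3 + 4 = 16 / 3\<close>, rounded up to 6, for L^2.\<close>
  define M where "M = max (4 * K1) (6 * K2)"
  have M: "M > 0" "4 * K1 \<le> M" "6 * K2 \<le> M" using K1(1) by (auto simp: M_def)
  show ?thesis
  proof (rule that[of "2 * M"])
    show "2 * M > 0" using M by simp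
    fix u :: "real \<Rightarrow> real^'n \<Rightarrow> real" and \<delta> t w
    assume \<delta>: "\<delta> > 0" and \<delta>s: "real CARD('n) * l * lam * \<delta>\<^sup>2 \<le> 1 / 2" and t: "t > 0"
      and mod: "\<And>s. 0 < s \<Longrightarrow> s < t \<Longrightarrow> u s \<in> borel_measurable borel \<and> orlicz_mod (u s) \<delta> \<le> 1"
      and bd: "\<And>s. 0 < s \<Longrightarrow> s < t \<Longrightarrow> AE x in lborel. \<bar>u s x\<bar> \<le> \<delta> * s powr (- a)"
      and w [measurable]: "w \<in> borel_measurable borel"
      and weq: "AE x in lborel. set_integrable lborel {0..t} (\<lambda>s. heat (t - s) (\<lambda>y. f (u s y)) x) \<and>
         w x = (\<integral>s\<in>{0..t}. heat (t - s) (\<lambda>y. f (u s y)) x \<partial>lborel)"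
    have "r * lam * \<delta>\<^sup>2 \<le> 1 / 2" if "r \<le> n * l" for r
    proof -
      have "r * (lam * \<delta>\<^sup>2) \<le> n * l * (lam * \<delta>\<^sup>2)" using lam by (intro mult_right_mono that) auto
      also have "\<dots> \<le> 1 / 2" using \<delta>s by (simp add: n_def mult.assoc)
      finally show ?thesis by (simp only: mult.assoc)
    qed
    with order_trans[OF \<rho>(4) nnl] nnl have sm: "\<rho> * lam * \<delta>\<^sup>2 \<le> 1 / 2" "n * lam * \<delta>\<^sup>2 \<le> 1 / 2"
      by blast+
    let ?h = "\<lambda>s x. heat (t - s) (\<lambda>y. f (u s y)) x"
    define A where "A = M * \<delta> powr l"
    have A: "A > 0" using M \<delta> by (simp add: A_def)
    \<comment> \<open>The cutoff makes \<open>F s\<close> vanish identically outside the open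
      interval, so continuity in \<open>x\<close> holds for every real \<open>s\<close>.\<close>
    define F where "F s x = indicator {0<..<t} s * ?h s x" for s x

    have sup: "\<bar>\<integral>s\<in>{0..t}. ?h s x \<partial>lborel\<bar> \<le> A" for x
    proof -
      have le: "ennreal \<bar>?h s x\<bar> * indicator {0<..<t} s
          \<le> ennreal (K1 * \<delta> powr l) * (ennreal ((t - s) powr (- (1/2)) * s powr (- (1/2))) * indicator {0<..<t} s)" for s
      proof (cases "0 < s \<and> s < t")
        case True
        then have s: "0 < s" "s < t" by auto
        have us: "u s \<in> borel_measurable borel" "orlicz_mod (u s) \<delta> \<le> 1" using mod[OF s] by auto
        have "\<bar>?h s x\<bar> \<le> (t - s) powr (- (1 / 2)) * (K1 * \<delta> powr l * (s powr (- a)) powr ((l - 1) / 2))"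
          using s by (intro K1(2) us \<delta> sm bd disjI2) auto
        also have "(s powr (- a)) powr ((l - 1) / 2) = s powr (- (1/2))"
          using a by (simp add: powr_powr)
        finally show ?thesis
          using s K1(1) by (simp add: ennreal_leI mult_ac flip: ennreal_mult)
      qed auto
      have "ennreal \<bar>\<integral>s\<in>{0..t}. ?h s x \<partial>lborel\<bar> \<le> (\<integral>\<^sup>+s. ennreal \<bar>?h s x\<bar> * indicator {0<..<t} s \<partial>lborel)"
        by (rule abs_set_integral_le_nn_integral)
      also have "\<dots> \<le> (\<integral>\<^sup>+s. ennreal (K1 * \<delta> powr l) * (ennreal ((t - s) powr (- (1/2)) * s powr (- (1/2))) * indicator {0<..<t} s) \<partial>lborel)"
        by (intro nn_integral_mono le)
      also have "\<dots> = ennreal (K1 * \<delta> powr l) * (\<integral>\<^sup>+s. ennreal ((t - s) powr (- (1/2)) * s powr (- (1/2))) * indicator {0<..<t} s \<partial>lborel)"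
        by (rule nn_integral_cmult) measurable
      also have "\<dots> \<le> ennreal (K1 * \<delta> powr l) * ennreal (1 / (1 - 1/2) + 1 / (1 - 1/2))"
        using t by (intro mult_left_mono nn_integral_beta_le) auto
      also have "\<dots> = ennreal (4 * K1 * \<delta> powr l)"
        using K1(1) by (subst ennreal_mult[symmetric]) (auto simp: mult_ac)
      finally have "\<bar>\<integral>s\<in>{0..t}. ?h s x \<partial>lborel\<bar> \<le> 4 * K1 * \<delta> powr l"
        using K1(1) by (subst (asm) ennreal_le_iff) auto
      also have "\<dots> \<le> A" unfolding A_def using M by (intro mult_right_mono) auto
      finally show ?thesis .
    qed

    have Lr: "(\<integral>\<^sup>+y. ennreal (\<bar>f (u s y)\<bar> powr \<rho>) \<partial>lborel) \<le> ennreal ((K2 * \<delta> powr l * s powr (- (3/4))) powr \<rho>)"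
      if s: "0 < s" "s < t" for s
    proof -
      have us: "u s \<in> borel_measurable borel" "orlicz_mod (u s) \<delta> \<le> 1" using mod[OF s] by auto
      have "(\<integral>\<^sup>+y. ennreal (\<bar>f (u s y)\<bar> powr \<rho>) \<partial>lborel)
          \<le> ennreal ((K2 * \<delta> powr l * (s powr (- a)) powr (3 / 4 * (l - 1))) powr \<rho>)"
        using s by (intro K2(2) us \<delta> sm bd disjI2) auto
      also have "(s powr (- a)) powr (3 / 4 * (l - 1)) = s powr (- (3/4))"
      proof -
        have "a * (3 / 4 * (l - 1)) = 3/4" using a(3) by (simp add: algebra_simps)
        then show ?thesis by (simp add: powr_powr)
      qed
      finally show ?thesis .
    qed

    \<comment> \<open>Exchanging the integrals requires joint measurability. The mild formulation
      gives measurability in \<open>s\<close> for almost every \<open>x\<close>, through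
      integrability; heat smoothing gives continuity in \<open>x\<close>.\<close>
    have Fm: "(\<lambda>(s, x). F s x) \<in> borel_measurable (borel \<Otimes>\<^sub>M borel)"
    proof (rule caratheodory_measurable)
      fix s
      show "continuous_on UNIV (F s)"
      proof (cases "0 < s \<and> s < t")
        case True
        then have s: "0 < s" "s < t" by auto
        have [measurable]: "u s \<in> borel_measurable borel" using mod[OF s] by auto
        have "continuous_on UNIV (heat (t - s) (\<lambda>y. f (u s y)))"
          by (rule continuous_on_heat[OF _ \<rho>(1)])
             (use s Lr[OF s] in \<open>auto intro: le_less_trans\<close>)
        then show ?thesis using s by (simp add: F_def[abs_def])
      qed (auto simp: F_def[abs_def])
    next
      show "AE x in lborel. (\<lambda>s. F s x) \<in> borel_measurable borel"
        using weq
      proof eventually_elim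
        case (elim x)
        then have [measurable]: "(\<lambda>s. indicator {0..t} s *\<^sub>R ?h s x) \<in> borel_measurable borel"
          by (auto simp: set_integrable_def)
        have "(\<lambda>s. indicator {0<..<t} s * (indicator {0..t} s *\<^sub>R ?h s x)) \<in> borel_measurable borel"
          by measurable
        also have "(\<lambda>s. indicator {0<..<t} s * (indicator {0..t} s *\<^sub>R ?h s x)) = (\<lambda>s. F s x)"
          by (auto simp: F_def indicator_def)
        finally show ?case .
      qed
    qed

    have L2: "(\<integral>\<^sup>+x. (\<integral>\<^sup>+s. ennreal \<bar>F s x\<bar> * indicator {0<..<t} s \<partial>lborel)\<^sup>2 \<partial>lborel) \<le> ennreal (A\<^sup>2)"
    proof (rule minkowski_L2[OF Fm, where H="\<lambda>s. (t - s) powr (- (1/4)) * (K2 * \<delta> powr l * s powr (- (3/4)))"])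
      fix s assume "s \<in> {0<..<t}"
      then have s: "0 < s" "s < t" by auto
      have [measurable]: "u s \<in> borel_measurable borel" using mod[OF s] by auto
      show "(t - s) powr (- (1/4)) * (K2 * \<delta> powr l * s powr (- (3/4))) > 0"
        using s K2(1) \<delta> by simp
      have "(\<integral>\<^sup>+x. ennreal ((?h s x)\<^sup>2) \<partial>lborel)
        \<le> ennreal (((t - s) powr (- real CARD('n) / 2 * (1 / \<rho> - 1 / 2)) * (K2 * \<delta> powr l * s powr (- (3/4))))\<^sup>2)"
        using s K2(1) by (intro heat_L2_le Lr \<rho>) auto
      then show "(\<integral>\<^sup>+x. ennreal ((F s x)\<^sup>2) \<partial>lborel)
        \<le> ennreal (((t - s) powr (- (1/4)) * (K2 * \<delta> powr l * s powr (- (3/4))))\<^sup>2)"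
        using s unfolding ex by (simp add: F_def)
    next
      have "(\<integral>\<^sup>+s. ennreal ((t - s) powr (- (1/4)) * (K2 * \<delta> powr l * s powr (- (3/4)))) * indicator {0<..<t} s \<partial>lborel)
        = (\<integral>\<^sup>+s. ennreal (K2 * \<delta> powr l) * (ennreal ((t - s) powr (- (1/4)) * s powr (- (3/4))) * indicator {0<..<t} s) \<partial>lborel)"
        using K2(1) by (intro nn_integral_cong) (simp add: indicator_def mult_ac flip: ennreal_mult)
      also have "\<dots> = ennreal (K2 * \<delta> powr l) * (\<integral>\<^sup>+s. ennreal ((t - s) powr (- (1/4)) * s powr (- (3/4))) * indicator {0<..<t} s \<partial>lborel)"
        by (rule nn_integral_cmult) measurable
      also have "\<dots> \<le> ennreal (K2 * \<delta> powr l) * ennreal (1 / (1 - 1/4) + 1 / (1 - 3/4))"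
        using t by (intro mult_left_mono nn_integral_beta_le) auto
      also have "\<dots> = ennreal (16 / 3 * K2 * \<delta> powr l)"
        using K2(1) by (subst ennreal_mult[symmetric]) (auto simp: mult_ac)
      also have "\<dots> \<le> ennreal A"
        unfolding A_def using M K2(1) by (intro ennreal_leI mult_right_mono) auto
      finally show "(\<integral>\<^sup>+s. ennreal ((t - s) powr (- (1/4)) * (K2 * \<delta> powr l * s powr (- (3/4)))) * indicator {0<..<t} s \<partial>lborel) \<le> ennreal A" .
    qed (use A in auto)

    have "orlicz_mod w (2 * A) \<le> 1"
    proof (rule orlicz_mod_le_of_bounded[OF A w])
      show "AE x in lborel. \<bar>w x\<bar> \<le> A"
        using weq by eventually_elim (use sup in simp)
      have "(\<integral>\<^sup>+x. ennreal ((w x)\<^sup>2) \<partial>lborel)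
          \<le> (\<integral>\<^sup>+x. (\<integral>\<^sup>+s. ennreal \<bar>F s x\<bar> * indicator {0<..<t} s \<partial>lborel)\<^sup>2 \<partial>lborel)"
      proof (intro nn_integral_mono_AE, use weq in eventually_elim)
        case (elim x)
        have "ennreal \<bar>w x\<bar> \<le> (\<integral>\<^sup>+s. ennreal \<bar>?h s x\<bar> * indicator {0<..<t} s \<partial>lborel)"
          using elim abs_set_integral_le_nn_integral by simp
        also have "\<dots> = (\<integral>\<^sup>+s. ennreal \<bar>F s x\<bar> * indicator {0<..<t} s \<partial>lborel)"
          by (intro nn_integral_cong) (simp add: F_def indicator_def)
        finally have "(ennreal \<bar>w x\<bar>)\<^sup>2 \<le> (\<integral>\<^sup>+s. ennreal \<bar>F s x\<bar> * indicator {0<..<t} s \<partial>lborel)\<^sup>2"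
          by (intro power_mono) auto
        then show ?case by (simp add: ennreal_power)
      qed
      also note L2
      finally show "(\<integral>\<^sup>+x. ennreal ((w x)\<^sup>2) \<partial>lborel) \<le> ennreal (A\<^sup>2)" .
    qed
    then show "orlicz_mod w (2 * M * \<delta> powr l) \<le> 1" by (simp add: A_def mult.assoc)
  qed
qed

subsection \<open>Continuity argument and decay\<close>

text \<open>Write \<open>v\<close> as the difference plus \<open>w\<close> and add modulars, with
  slack \<open>e / 2\<close> on each. It first has to be seen that the difference admits some finite
  Luxemburg bound. The use is continuity in time of the norm.\<close>

lemma expL2_norm_diff_le:
  fixes v w :: "real^'n \<Rightarrow> real"
  assumes v: "v \<in> expL2" and w: "w \<in> expL2"
  shows "expL2_norm v - expL2_norm w \<le> expL2_norm (\<lambda>x. v x - w x)"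
proof -
  note [measurable] = expL2_measurable[OF v] expL2_measurable[OF w]
  let ?d = "\<lambda>x. v x - w x"
  have "orlicz_mod (\<lambda>x. - w x) \<alpha> = orlicz_mod w \<alpha>" for \<alpha> by (simp add: orlicz_mod_def)
  moreover obtain \<alpha> \<beta> where "\<alpha> > 0" "orlicz_mod v \<alpha> \<le> 1" "\<beta> > 0" "orlicz_mod w \<beta> \<le> 1"
    using expL2_luxemburg[OF v] expL2_luxemburg[OF w] by blast
  ultimately have d: "\<exists>\<gamma>>0. orlicz_mod ?d \<gamma> \<le> 1"
    using orlicz_mod_add[of v "\<lambda>x. - w x" \<alpha> \<beta>] by (intro exI[of _ "\<alpha> + \<beta>"]) auto
  show ?thesis
  proof (rule field_le_epsilon)
    fix e :: real assume e: "e > 0"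
    have *: "expL2_norm ?d + e/2 > 0" "orlicz_mod ?d (expL2_norm ?d + e/2) \<le> 1"
      using e by (auto intro!: expL2_norm_less[OF d])
    have **: "expL2_norm w + e/2 > 0" "orlicz_mod w (expL2_norm w + e/2) \<le> 1"
      using e by (auto intro!: expL2_norm_less[OF expL2_luxemburg[OF w]])
    have "expL2_norm (\<lambda>x. ?d x + w x) \<le> (expL2_norm ?d + e/2) + (expL2_norm w + e/2)"
      using * ** by (intro expL2_norm_le orlicz_mod_add) auto
    then show "expL2_norm v - expL2_norm w \<le> expL2_norm ?d + e" by simp
  qed
qed

text \<open>The embedding into L^q followed by smoothing. At the critical \<open>q\<close> the decay
  exponent of the free evolution is exactly \<open>- a\<close>.\<close>

lemma heat_sup_expL2:
  fixes q :: real
  assumes q: "q \<ge> 2"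
  obtains K where "K > 0"
    "\<And>(v::real^'n \<Rightarrow> real) \<epsilon> t x. \<lbrakk>v \<in> borel_measurable borel; \<epsilon> > 0; orlicz_mod v \<epsilon> \<le> 1; t > 0\<rbrakk>
      \<Longrightarrow> \<bar>heat t v x\<bar> \<le> K * \<epsilon> * t powr (- real CARD('n) / (2 * q))"
proof -
  from orlicz_powr_exp_integral_le[OF q, where 'n='n] obtain C where C: "C > 0"
    "\<And>(v::real^'n \<Rightarrow> real) \<delta> c. \<lbrakk>v \<in> borel_measurable borel; \<delta> > 0; c * \<delta>\<^sup>2 \<le> 1 / 2; orlicz_mod v \<delta> \<le> 1\<rbrakk>
      \<Longrightarrow> (\<integral>\<^sup>+x. ennreal (\<bar>v x\<bar> powr q * exp (c * (v x)\<^sup>2)) \<partial>lborel) \<le> ennreal (C * \<delta> powr q)"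
    by blast
  show ?thesis
  proof (rule that[of "C powr (1 / q)"])
    show "C powr (1 / q) > 0" using C by simp
    fix v :: "real^'n \<Rightarrow> real" and \<epsilon> t :: real and x
    assume v: "v \<in> borel_measurable borel" "\<epsilon> > 0" "orlicz_mod v \<epsilon> \<le> 1" and t: "t > 0"
    have "(\<integral>\<^sup>+x. ennreal (\<bar>v x\<bar> powr q) \<partial>lborel) \<le> ennreal (C * \<epsilon> powr q)"
      using C(2)[of v \<epsilon> 0] v by simp
    also have "C * \<epsilon> powr q = (C powr (1 / q) * \<epsilon>) powr q"
      using C(1) v q by (simp add: powr_mult powr_powr)
    finally have "\<bar>heat t v x\<bar> \<le> t powr (- real CARD('n) / (2 * q)) * (C powr (1 / q) * \<epsilon>)"
      using t q v C(1) by (intro heat_sup_le) auto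
    then show "\<bar>heat t v x\<bar> \<le> C powr (1 / q) * \<epsilon> * t powr (- real CARD('n) / (2 * q))"
      by (simp add: mult_ac)
  qed
qed

text \<open>The right side of the growth condition vanishes as \<open>u\<close> tends to
  \<open>v\<close>, because of the factor \<open>\<bar>u - v\<bar>\<close>. Continuity yields Borel
  measurability of \<open>f\<close>.\<close>

lemma exp_nonlinearity_continuous:
  fixes f :: "real \<Rightarrow> real" and l C lam :: real
  assumes l: "l > 1"
    and fbound: "\<And>u v. \<bar>f u - f v\<bar> \<le> C * \<bar>u - v\<bar> *
                    (\<bar>u\<bar> powr (l - 1) * exp (lam * u^2) + \<bar>v\<bar> powr (l - 1) * exp (lam * v^2))"
  shows "continuous_on UNIV f"
  unfolding continuous_on_def
proof
  fix v
  have "((\<lambda>u. C * \<bar>u - v\<bar> * (\<bar>u\<bar> powr (l - 1) * exp (lam * u^2) + \<bar>v\<bar> powr (l - 1) * exp (lam * v^2)))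
      \<longlongrightarrow> C * \<bar>v - v\<bar> * (\<bar>v\<bar> powr (l - 1) * exp (lam * v^2) + \<bar>v\<bar> powr (l - 1) * exp (lam * v^2))) (at v)"
    using l by (intro tendsto_intros tendsto_powr') auto
  then have "((\<lambda>u. C * \<bar>u - v\<bar> * (\<bar>u\<bar> powr (l - 1) * exp (lam * u^2) + \<bar>v\<bar> powr (l - 1) * exp (lam * v^2))) \<longlongrightarrow> 0) (at v)"
    by simp
  then have "((\<lambda>u. f u - f v) \<longlongrightarrow> 0) (at v)"
    by (rule Lim_null_comparison[rotated]) (use fbound in auto)
  then show "(f \<longlongrightarrow> f v) (at v)" by (rule LIM_zero_cancel)
qed

text \<open>The bootstrap. \<open>\<delta>\<close> and \<open>\<epsilon>\<close> are fixed before
  the solution, whereas the step \<open>h\<close> depends on the solution and on the final time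
  \<open>Ts\<close>.\<close>

lemma mild_solution_bound:
  fixes f :: "real \<Rightarrow> real" and l C0 lam a :: real
  assumes C0: "C0 > 0" and fb: "\<And>v. \<bar>f v\<bar> \<le> C0 * \<bar>v\<bar> powr l * exp (lam * v\<^sup>2)"
    and f [measurable]: "f \<in> borel_measurable borel"
    and l: "l \<ge> 2" and nl: "real CARD('n) * (l - 1) \<ge> 4" and lam: "lam > 0"
    and a_def: "a = 1 / (l - 1)"
  obtains \<delta> \<epsilon> where "\<delta> > 0" "\<epsilon> > 0"
    "\<And>u0 (u :: real \<Rightarrow> real^'n \<Rightarrow> real) t. \<lbrakk>u0 \<in> expL2_0; expL2_norm u0 < \<epsilon>; global_mild_solution f u0 u; t > 0\<rbrakk>
      \<Longrightarrow> u t \<in> borel_measurable borel \<and> orlicz_mod (u t) \<delta> \<le> 1 \<and> (AE x in lborel. \<bar>u t x\<bar> \<le> \<delta> * t powr (- a))"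
proof -
  define n where "n = real CARD('n)"
  have n1: "n \<ge> 1" by (simp add: n_def Suc_leI)
  have a: "0 < a" "a \<le> 1" using l by (auto simp: a_def)
  define q where "q = n / (2 * a)"
  have q: "q \<ge> 2" using nl l by (simp add: q_def n_def a_def field_simps)
  have qa: "- real CARD('n) / (2 * q) = - a" using n1 a by (simp add: q_def n_def)
  obtain K0 where K0: "K0 > 0"
    "\<And>(v::real^'n \<Rightarrow> real) \<epsilon> t x. \<lbrakk>v \<in> borel_measurable borel; \<epsilon> > 0; orlicz_mod v \<epsilon> \<le> 1; t > 0\<rbrakk>
      \<Longrightarrow> \<bar>heat t v x\<bar> \<le> K0 * \<epsilon> * t powr (- a)"
    using heat_sup_expL2[OF q, where 'n='n] unfolding qa by blast
  obtain K1 where K1: "K1 > 0"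
    "\<And>(u :: real \<Rightarrow> real^'n \<Rightarrow> real) \<delta> t T x. \<lbrakk>\<delta> > 0; real CARD('n) * l * lam * \<delta>\<^sup>2 \<le> 1 / 2; t > 0; 0 \<le> T; T \<le> t;
       \<And>s. 0 < s \<Longrightarrow> s < t \<Longrightarrow> u s \<in> borel_measurable borel \<and> orlicz_mod (u s) \<delta> \<le> 1;
       \<And>s. 0 < s \<Longrightarrow> s \<le> T \<Longrightarrow> AE x in lborel. \<bar>u s x\<bar> \<le> \<delta> * s powr (- a)\<rbrakk>
     \<Longrightarrow> \<bar>\<integral>s\<in>{0..t}. heat (t - s) (\<lambda>y. f (u s y)) x \<partial>lborel\<bar> \<le> K1 * \<delta> powr l * (t powr (- a) + sqrt (t - T))"
    using duhamel_decay[OF C0 fb f l nl lam a_def] by blast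
  obtain K2 where K2: "K2 > 0"
    "\<And>(u :: real \<Rightarrow> real^'n \<Rightarrow> real) \<delta> t w. \<lbrakk>\<delta> > 0; real CARD('n) * l * lam * \<delta>\<^sup>2 \<le> 1 / 2; t > 0;
       \<And>s. 0 < s \<Longrightarrow> s < t \<Longrightarrow> u s \<in> borel_measurable borel \<and> orlicz_mod (u s) \<delta> \<le> 1;
       \<And>s. 0 < s \<Longrightarrow> s < t \<Longrightarrow> AE x in lborel. \<bar>u s x\<bar> \<le> \<delta> * s powr (- a);
       w \<in> borel_measurable borel;
       AE x in lborel. set_integrable lborel {0..t} (\<lambda>s. heat (t - s) (\<lambda>y. f (u s y)) x) \<and>
         w x = (\<integral>s\<in>{0..t}. heat (t - s) (\<lambda>y. f (u s y)) x \<partial>lborel)\<rbrakk>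
     \<Longrightarrow> orlicz_mod w (K2 * \<delta> powr l) \<le> 1"
    using duhamel_orlicz[OF C0 fb f l nl lam a_def] by blast
  \<comment> \<open>With \<open>\<delta> \<le> 1\<close> and \<open>l \<ge> 2\<close>,
    \<open>\<delta> powr l\<close> is at most \<open>\<delta>^2\<close>. The next two bounds then
    make both Duhamel constants at most \<open>\<delta> / 4\<close>, and the last one yields the
    smallness condition for the exponential.\<close>
  define \<delta> where "\<delta> = Min {1, 1 / (4 * K1), 1 / (4 * K2), 1 / (2 * (n * l * lam))}"
  have nll: "n * l * lam > 0" using n1 l lam by simp
  have \<delta>: "\<delta> > 0" "\<delta> \<le> 1" "\<delta> \<le> 1 / (4 * K1)" "\<delta> \<le> 1 / (4 * K2)" "\<delta> \<le> 1 / (2 * (n * l * lam))"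
    unfolding \<delta>_def using K1(1) K2(1) nll by auto
  have \<delta>2: "\<delta>\<^sup>2 \<le> \<delta>" using \<delta> by (simp add: power2_eq_square mult_left_le)
  have "\<delta> powr l \<le> \<delta> powr 2" using \<delta> l by (intro powr_mono') auto
  then have \<delta>l: "\<delta> powr l \<le> \<delta>\<^sup>2" using \<delta> by simp
  have K1\<delta>: "K1 * \<delta> powr l \<le> \<delta> / 4"
  proof -
    have "K1 * \<delta> powr l \<le> (K1 * \<delta>) * \<delta>" using \<delta>l K1(1) by (simp add: power2_eq_square mult_left_mono)
    also have "\<dots> \<le> (1 / 4) * \<delta>" using \<delta> K1(1) by (intro mult_right_mono) (auto simp: field_simps)
    finally show ?thesis by simp
  qed
  have K2\<delta>: "K2 * \<delta> powr l \<le> \<delta> / 4"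
  proof -
    have "K2 * \<delta> powr l \<le> (K2 * \<delta>) * \<delta>" using \<delta>l K2(1) by (simp add: power2_eq_square mult_left_mono)
    also have "\<dots> \<le> (1 / 4) * \<delta>" using \<delta> K2(1) by (intro mult_right_mono) (auto simp: field_simps)
    finally show ?thesis by simp
  qed
  have sm: "real CARD('n) * l * lam * \<delta>\<^sup>2 \<le> 1 / 2"
  proof -
    have "n * l * lam * \<delta>\<^sup>2 \<le> n * l * lam * \<delta>" using \<delta>2 nll by (intro mult_left_mono) auto
    also have "\<dots> \<le> 1 / 2" using \<delta>(5) nll by (simp add: field_simps)
    finally show ?thesis by (simp add: n_def)
  qed
  \<comment> \<open>The free evolution takes at most a quarter of \<open>\<delta>\<close> in each of
    the two bounds.\<close>
  define \<epsilon> where "\<epsilon> = min (\<delta> / 4) (\<delta> / (4 * K0))"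
  have \<epsilon>: "\<epsilon> > 0" "\<epsilon> \<le> \<delta> / 4" using \<delta> K0(1) by (auto simp: \<epsilon>_def)
  have K0\<epsilon>: "K0 * \<epsilon> \<le> \<delta> / 4"
  proof -
    have "\<epsilon> \<le> \<delta> / (4 * K0)" by (simp add: \<epsilon>_def)
    then show ?thesis using K0(1) by (simp add: field_simps)
  qed
  show ?thesis
  proof (rule that[OF \<delta>(1) \<epsilon>(1)])
    fix u0 and u :: "real \<Rightarrow> real^'n \<Rightarrow> real" and Ts :: real
    assume u0: "u0 \<in> expL2_0" "expL2_norm u0 < \<epsilon>" and sol: "global_mild_solution f u0 u" and Ts: "Ts > 0"
    define N where "N t = expL2_norm (u t)" for t
    have uE: "u t \<in> expL2" if "t \<ge> 0" for t
      using sol that by (auto simp: global_mild_solution_def expL2_0_def)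
    note um = expL2_measurable[OF uE]
    note lux = expL2_luxemburg[OF uE]
    have mod: "orlicz_mod (u t) \<beta> \<le> 1" if "t \<ge> 0" "N t < \<beta>" for t \<beta>
      using expL2_norm_less[OF lux[OF that(1)]] that(2) by (simp add: N_def)
    have u_0: "u 0 = u0" using sol by (simp add: global_mild_solution_def)
    have N0: "N 0 < \<epsilon>" using u0 u_0 by (simp add: N_def)
    have mod0: "orlicz_mod u0 \<epsilon> \<le> 1" using mod[of 0 \<epsilon>] N0 u_0 by simp
    have u0m [measurable]: "u0 \<in> borel_measurable borel" using um[of 0] u_0 by simp
    have mild: "AE x in lborel. set_integrable lborel {0..t} (\<lambda>s. heat (t - s) (\<lambda>y. f (u s y)) x) \<and>
        u t x = heat t u0 x + (\<integral>s\<in>{0..t}. heat (t - s) (\<lambda>y. f (u s y)) x \<partial>lborel)" if "t > 0" for t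
      using sol that by (simp add: global_mild_solution_def)
    have contN: "continuous_on {0..Ts} N"
      unfolding continuous_on_def
    proof
      fix t assume t: "t \<in> {0..Ts}"
      have lim: "((\<lambda>s. expL2_norm (\<lambda>x. u s x - u t x)) \<longlongrightarrow> 0) (at t within {0..Ts})"
      proof (rule tendsto_within_subset)
        show "((\<lambda>s. expL2_norm (\<lambda>x. u s x - u t x)) \<longlongrightarrow> 0) (at t within {0..})"
          using sol t unfolding global_mild_solution_def by simp
      qed auto
      have "\<forall>\<^sub>F s in at t within {0..Ts}. norm (N s - N t) \<le> expL2_norm (\<lambda>x. u s x - u t x)"
        unfolding eventually_at_filter
      proof (intro always_eventually allI impI)
        fix s assume "s \<in> {0..Ts}"
        then have st: "u s \<in> expL2" "u t \<in> expL2" using t uE by auto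
        have "expL2_norm (\<lambda>x. u t x - u s x) = expL2_norm (\<lambda>x. u s x - u t x)"
          by (simp add: expL2_norm_def orlicz_mod_def power2_commute)
        then show "norm (N s - N t) \<le> expL2_norm (\<lambda>x. u s x - u t x)"
          using expL2_norm_diff_le[OF st] expL2_norm_diff_le[OF st(2,1)] by (simp add: N_def abs_le_iff)
      qed
      then have "((\<lambda>s. N s - N t) \<longlongrightarrow> 0) (at t within {0..Ts})"
        using lim by (rule Lim_null_comparison)
      then show "(N \<longlongrightarrow> N t) (at t within {0..Ts})" by (rule LIM_zero_cancel)
    qed
    have "uniformly_continuous_on {0..Ts} N"
      using contN by (intro compact_uniformly_continuous) auto
    then obtain h0 where h0: "h0 > 0"
      "\<And>s s'. s \<in> {0..Ts} \<Longrightarrow> s' \<in> {0..Ts} \<Longrightarrow> dist s' s < h0 \<Longrightarrow> dist (N s') (N s) < \<delta> / 2"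
      using \<delta>(1) unfolding uniformly_continuous_on_def by (meson half_gt_zero)
    \<comment> \<open>The first entry keeps the variation of \<open>N\<close> over one step below
      \<open>\<delta> / 2\<close>. The second makes the tail term at most a quarter of
      \<open>\<delta> * Ts powr (- a)\<close>, hence of \<open>\<delta> * t powr (- a)\<close> for
      every \<open>t \<le> Ts\<close>.\<close>
    define h where "h = min (h0 / 2) ((\<delta> / 4 * Ts powr (- a) / (K1 * \<delta> powr l))\<^sup>2)"
    have h: "h > 0" "h < h0" using h0(1) \<delta>(1) K1(1) Ts by (auto simp: h_def)
    have sqrt_h: "K1 * \<delta> powr l * sqrt h \<le> \<delta> / 4 * Ts powr (- a)"
    proof -
      have "sqrt h \<le> sqrt ((\<delta> / 4 * Ts powr (- a) / (K1 * \<delta> powr l))\<^sup>2)"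
        unfolding h_def by (intro real_sqrt_le_mono) (rule min.cobounded2)
      also have "\<dots> = \<delta> / 4 * Ts powr (- a) / (K1 * \<delta> powr l)" using \<delta>(1) K1(1) by (subst real_sqrt_abs) auto
      finally show ?thesis using \<delta>(1) K1(1) by (simp add: field_simps)
    qed
    define P where "P T \<longleftrightarrow> (\<forall>s. 0 \<le> s \<and> s \<le> T \<longrightarrow> N s < \<delta>) \<and>
        (\<forall>s. 0 < s \<and> s \<le> T \<longrightarrow> (AE x in lborel. \<bar>u s x\<bar> \<le> \<delta> * s powr (- a)))" for T
    \<comment> \<open>Datum and Duhamel term contribute a quarter each. This strict gain lets the
      norm bound survive the next time step.\<close>
    have half: "N t \<le> \<delta> / 2" if P: "P T" and t: "0 \<le> t" "t \<le> T" for t T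
    proof (cases "t = 0")
      case True
      then show ?thesis using N0 \<epsilon>(2) \<delta>(1) by simp
    next
      case False
      then have t0: "t > 0" using t by simp
      define w where "w = (\<lambda>x. u t x - heat t u0 x)"
      have [measurable]: "u t \<in> borel_measurable borel" by (rule um) (use t in auto)
      have wm [measurable]: "w \<in> borel_measurable borel" unfolding w_def by measurable
      have w: "orlicz_mod w (K2 * \<delta> powr l) \<le> 1"
      proof (rule K2(2)[OF \<delta>(1) sm t0 _ _ wm])
        show "u s \<in> borel_measurable borel \<and> orlicz_mod (u s) \<delta> \<le> 1" if "0 < s" "s < t" for s
          using that P t um mod by (auto simp: P_def)
        show "AE x in lborel. \<bar>u s x\<bar> \<le> \<delta> * s powr (- a)" if "0 < s" "s < t" for s
          using that P t by (auto simp: P_def)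
        show "AE x in lborel. set_integrable lborel {0..t} (\<lambda>s. heat (t - s) (\<lambda>y. f (u s y)) x) \<and>
          w x = (\<integral>s\<in>{0..t}. heat (t - s) (\<lambda>y. f (u s y)) x \<partial>lborel)"
          using mild[OF t0] by eventually_elim (auto simp: w_def)
      qed
      have "orlicz_mod (heat t u0) \<epsilon> \<le> 1"
        using orlicz_mod_heat_le[OF t0 u0m] mod0 by (rule order_trans)
      then have "orlicz_mod (\<lambda>x. heat t u0 x + w x) (\<epsilon> + K2 * \<delta> powr l) \<le> 1"
        using \<epsilon>(1) w K2(1) \<delta>(1) by (intro orlicz_mod_add) auto
      then have "N t \<le> \<epsilon> + K2 * \<delta> powr l"
        unfolding N_def using \<epsilon>(1) K2(1) by (intro expL2_norm_le) (auto simp: w_def add_pos_nonneg)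
      then show ?thesis using \<epsilon>(2) K2\<delta> by simp
    qed
    \<comment> \<open>On the new piece \<open>N\<close> grows by less than
      \<open>\<delta> / 2\<close> from a value at most \<open>\<delta> / 2\<close>. The supremum
      bound there is the sum of three quarters of its target: free evolution, Duhamel part up to
      \<open>T\<close>, and tail.\<close>
    have step: "P (min (T + h) Ts)" if P: "P T" and T: "0 \<le> T" "T \<le> Ts" for T
    proof -
      have Ns: "N s < \<delta>" if s: "0 \<le> s" "s \<le> T + h" "s \<le> Ts" for s
      proof (cases "s \<le> T")
        case True
        then show ?thesis using P s by (auto simp: P_def)
      next
        case False
        then have "dist (N s) (N T) < \<delta> / 2"
          using s T h by (intro h0(2)) (auto simp: dist_real_def)
        then show ?thesis using half[OF P T(1) order_refl] unfolding dist_real_def by linarith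
      qed
      have "AE x in lborel. \<bar>u t x\<bar> \<le> \<delta> * t powr (- a)" if t: "0 < t" "t \<le> T + h" "t \<le> Ts" for t
      proof (cases "t \<le> T")
        case True
        then show ?thesis using P t by (auto simp: P_def)
      next
        case False
        have D: "\<bar>\<integral>s\<in>{0..t}. heat (t - s) (\<lambda>y. f (u s y)) x \<partial>lborel\<bar> \<le> K1 * \<delta> powr l * (t powr (- a) + sqrt (t - T))" for x
        proof (rule K1(2)[OF \<delta>(1) sm t(1) T(1)])
          show "T \<le> t" using False by simp
          show "u s \<in> borel_measurable borel \<and> orlicz_mod (u s) \<delta> \<le> 1" if "0 < s" "s < t" for s
            using that t um mod Ns by auto
          show "AE x in lborel. \<bar>u s x\<bar> \<le> \<delta> * s powr (- a)" if "0 < s" "s \<le> T" for s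
            using that P by (auto simp: P_def)
        qed
        have "K1 * \<delta> powr l * sqrt (t - T) \<le> K1 * \<delta> powr l * sqrt h"
          using t K1(1) by (intro mult_left_mono) auto
        also note sqrt_h
        also have "\<delta> / 4 * Ts powr (- a) \<le> \<delta> / 4 * t powr (- a)"
          using t a \<delta>(1) by (intro mult_left_mono powr_mono2') auto
        finally have s3: "K1 * \<delta> powr l * sqrt (t - T) \<le> \<delta> / 4 * t powr (- a)" .
        have s2: "K1 * \<delta> powr l * t powr (- a) \<le> \<delta> / 4 * t powr (- a)"
          by (intro mult_right_mono K1\<delta>) auto
        have s1: "\<bar>heat t u0 x\<bar> \<le> \<delta> / 4 * t powr (- a)" for x
        proof -
          have "\<bar>heat t u0 x\<bar> \<le> K0 * \<epsilon> * t powr (- a)" using \<epsilon>(1) mod0 t by (intro K0(2)) auto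
          also have "\<dots> \<le> \<delta> / 4 * t powr (- a)" by (intro mult_right_mono K0\<epsilon>) auto
          finally show ?thesis .
        qed
        have pos: "\<delta> * t powr (- a) \<ge> 0" using \<delta>(1) by simp
        show ?thesis
          using mild[OF t(1)]
        proof eventually_elim
          case (elim x)
          then have "\<bar>u t x\<bar> \<le> \<bar>heat t u0 x\<bar> + \<bar>\<integral>s\<in>{0..t}. heat (t - s) (\<lambda>y. f (u s y)) x \<partial>lborel\<bar>" by simp
          then show ?case using s1[of x] D[of x] s2 s3 pos by (simp add: distrib_left)
        qed
      qed
      with Ns show ?thesis by (auto simp: P_def)
    qed
    \<comment> \<open>At time 0 the supremum clause is vacuous. Since \<open>h\<close> is fixed,
      finitely many steps reach \<open>Ts\<close>.\<close>
    have Pk: "P (min (real k * h) Ts)" for k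
    proof (induction k)
      case 0
      have "N 0 < \<delta>" using N0 \<epsilon>(2) \<delta>(1) by simp
      then show ?case using Ts by (auto simp: P_def dest: order_antisym)
    next
      case (Suc k)
      have "P (min (min (real k * h) Ts + h) Ts)"
        using h Ts by (intro step Suc) auto
      moreover have "min (min (real k * h) Ts + h) Ts = min (real (Suc k) * h) Ts"
        using h by (auto simp: min_def algebra_simps)
      ultimately show ?case by simp
    qed
    obtain k :: nat where "Ts / h < real k" using reals_Archimedean2 by blast
    then have "Ts \<le> real k * h" using h by (simp add: field_simps)
    with Pk[of k] have "P Ts" by (simp add: min_absorb2)
    then show "u Ts \<in> borel_measurable borel \<and> orlicz_mod (u Ts) \<delta> \<le> 1 \<and> (AE x in lborel. \<bar>u Ts x\<bar> \<le> \<delta> * Ts powr (- a))"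
      using Ts um mod by (auto simp: P_def)
  qed
qed

section \<open>Decay in the Lebesgue norms by interpolation\<close>

theorem theorem1p5:
  fixes N :: nat and \<sigma> :: real and f :: "real \<Rightarrow> real" and l C lam :: real and p :: ereal
  assumes N_def: "N = CARD('n)"
    and l1: "l \<ge> 1 + 4 / real N" and l2: "l \<ge> 2"
    and f0: "f 0 = 0"
    and Cpos: "C > 0" and lpos: "lam > 0"
    and fbound: "\<And>u v. \<bar>f u - f v\<bar> \<le> C * \<bar>u - v\<bar> *
                    (\<bar>u\<bar> powr (l - 1) * exp (lam * u^2) + \<bar>v\<bar> powr (l - 1) * exp (lam * v^2))"
    and prange: "if N \<ge> 4 then ereal (real N * (l - 1) / 2) < p \<and> p < \<infinity>
                 else ereal (max l (2 * real N * (l - 1) / (4 - real N))) \<le> p"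
    and sigma_def: "\<sigma> = 1 / (l - 1) - (if p = \<infinity> then 0 else real N / (2 * real_of_ereal p))"
  shows "\<sigma> > 0 \<and>
    (\<exists>\<epsilon>>0. \<forall>u0 (u :: real \<Rightarrow> real^'n \<Rightarrow> real).
       u0 \<in> expL2_0 \<and> expL2_norm u0 < \<epsilon> \<and> global_mild_solution f u0 u \<longrightarrow>
       (\<exists>K>0. \<forall>t>0. Lp_norm_le p (u t) (K * t powr (- \<sigma>))))"
proof -
  define a q where "a = 1 / (l - 1)" and "q = real N * (l - 1) / 2"
  have N1: "real N \<ge> 1" by (simp add: N_def Suc_leI)
  have nl: "real CARD('n) * (l - 1) \<ge> 4" using l1 N1 by (simp add: N_def field_simps)
  have q2: "q \<ge> 2" using nl by (simp add: q_def N_def)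
  have a0: "a > 0" and aq: "a * q = real N / 2" using l2 by (auto simp: a_def q_def)
  \<comment> \<open>Both forms of the exponent range lie above the critical \<open>q\<close>: in
    dimension below 4, \<open>4 - real N < 4\<close> makes the second entry of the maximum larger
    than \<open>q\<close>.\<close>
  have pq: "ereal q < p"
  proof (cases "N \<ge> 4")
    case False
    then have N3: "real N \<le> 3" by simp
    have "4 - real N < 4" "4 - real N > 0" "N > 0" using N1 N3 by auto
    then have "q < 2 * real N * (l - 1) / (4 - real N)" using l2 by (simp add: q_def field_simps)
    then have "ereal q < ereal (max l (2 * real N * (l - 1) / (4 - real N)))"
      by (simp add: less_max_iff_disj flip: ereal_max)
    then show ?thesis using prange False by (auto intro: less_le_trans)
  qed (use prange in \<open>auto simp: q_def\<close>)
  \<comment> \<open>The growth condition against 0, where \<open>f\<close> vanishes and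
    \<open>0 powr (l - 1) = 0\<close> removes the second summand.\<close>
  have fb: "\<bar>f v\<bar> \<le> C * \<bar>v\<bar> powr l * exp (lam * v\<^sup>2)" for v
  proof -
    have "\<bar>v\<bar> * \<bar>v\<bar> powr (l - 1) = \<bar>v\<bar> powr l" using l2 by (cases "v = 0") (auto simp: powr_mult_base)
    moreover have "\<bar>f v\<bar> \<le> C * (\<bar>v\<bar> * \<bar>v\<bar> powr (l - 1)) * exp (lam * v\<^sup>2)"
      using fbound[of v 0] f0 by (simp add: mult.assoc)
    ultimately show ?thesis by metis
  qed
  have fm: "f \<in> borel_measurable borel"
    using l2 by (intro borel_measurable_continuous_onI exp_nonlinearity_continuous[OF _ fbound]) auto
  obtain \<delta> \<epsilon> where \<delta>: "\<delta> > 0" and \<epsilon>: "\<epsilon> > 0" and bound: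
    "\<And>u0 (u :: real \<Rightarrow> real^'n \<Rightarrow> real) t. \<lbrakk>u0 \<in> expL2_0; expL2_norm u0 < \<epsilon>; global_mild_solution f u0 u; t > 0\<rbrakk>
      \<Longrightarrow> u t \<in> borel_measurable borel \<and> orlicz_mod (u t) \<delta> \<le> 1 \<and> (AE x in lborel. \<bar>u t x\<bar> \<le> \<delta> * t powr (- a))"
    using mild_solution_bound[OF Cpos fb fm l2 nl lpos a_def] by blast
  show ?thesis
  proof (cases "p = \<infinity>")
    case True
    then have \<sigma>: "\<sigma> = a" by (simp add: sigma_def a_def)
    have "Lp_norm_le p (u t) (\<delta> * t powr (- \<sigma>))"
      if "u0 \<in> expL2_0" "expL2_norm u0 < \<epsilon>" "global_mild_solution f u0 u" "t > 0"
      for u0 and u :: "real \<Rightarrow> real^'n \<Rightarrow> real" and t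
      using bound[OF that] by (simp add: Lp_norm_le_def True \<sigma>)
    with \<delta> \<epsilon> a0 show ?thesis unfolding \<sigma> by blast
  next
    case False
    then obtain r where r: "p = ereal r" using pq by (cases p) auto
    then have rq: "q < r" using pq by simp
    have \<sigma>: "\<sigma> = a - real N / (2 * r)" using False by (simp add: sigma_def a_def r)
    \<comment> \<open>This identity gives \<open>\<sigma> > 0\<close> and matches the powers of
      \<open>t\<close> after interpolation.\<close>
    have \<sigma>r: "\<sigma> * r = a * (r - q)" using rq q2 aq by (simp add: \<sigma> field_simps)
    have "\<sigma> * r > 0" unfolding \<sigma>r using a0 rq by simp
    then have \<sigma>0: "\<sigma> > 0" using rq q2 by (simp add: zero_less_mult_iff)
    from orlicz_powr_exp_integral_le[OF q2, where 'n='n] obtain D where D: "D > 0"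
      "\<And>(v::real^'n \<Rightarrow> real) \<delta> c. \<lbrakk>v \<in> borel_measurable borel; \<delta> > 0; c * \<delta>\<^sup>2 \<le> 1 / 2; orlicz_mod v \<delta> \<le> 1\<rbrakk>
        \<Longrightarrow> (\<integral>\<^sup>+x. ennreal (\<bar>v x\<bar> powr q * exp (c * (v x)\<^sup>2)) \<partial>lborel) \<le> ennreal (D * \<delta> powr q)"
      by blast
    define K where "K = D powr (1 / r) * \<delta>"
    have K: "K > 0" using D(1) \<delta> by (simp add: K_def)
    have "Lp_norm_le p (u t) (K * t powr (- \<sigma>))"
      if u: "u0 \<in> expL2_0" "expL2_norm u0 < \<epsilon>" "global_mild_solution f u0 u" and t: "t > 0"
      for u0 and u :: "real \<Rightarrow> real^'n \<Rightarrow> real" and t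
    proof -
      from bound[OF u t] have [measurable]: "u t \<in> borel_measurable borel"
        and mod: "orlicz_mod (u t) \<delta> \<le> 1" and bd: "AE x in lborel. \<bar>u t x\<bar> \<le> \<delta> * t powr (- a)" by auto
      \<comment> \<open>The supremum bound is spent on \<open>r - q\<close> powers of the solution;
        the remaining \<open>q\<close> powers are integrated by the Luxemburg bound.\<close>
      define A where "A = (\<delta> * t powr (- a)) powr (r - q)"
      have "(\<integral>\<^sup>+x. ennreal (\<bar>u t x\<bar> powr r) \<partial>lborel) \<le> (\<integral>\<^sup>+x. ennreal A * ennreal (\<bar>u t x\<bar> powr q) \<partial>lborel)"
      proof (intro nn_integral_mono_AE, use bd in eventually_elim)
        case (elim x)
        have "\<bar>u t x\<bar> powr r = \<bar>u t x\<bar> powr (r - q) * \<bar>u t x\<bar> powr q" by (simp flip: powr_add)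
        also have "\<dots> \<le> A * \<bar>u t x\<bar> powr q"
          unfolding A_def using elim rq by (intro mult_right_mono powr_mono2) auto
        finally show ?case by (simp add: A_def ennreal_leI flip: ennreal_mult)
      qed
      also have "\<dots> = ennreal A * (\<integral>\<^sup>+x. ennreal (\<bar>u t x\<bar> powr q) \<partial>lborel)"
        by (rule nn_integral_cmult) measurable
      also have "\<dots> \<le> ennreal A * ennreal (D * \<delta> powr q)"
        using D(2)[of "u t" \<delta> 0] \<delta> mod by (intro mult_left_mono) auto
      also have "\<dots> = ennreal (A * (D * \<delta> powr q))"
        using D(1) by (simp add: A_def ennreal_mult)
      also have "A * (D * \<delta> powr q) = (K * t powr (- \<sigma>)) powr r"
      proof -
        have "\<delta> powr (r - q) * \<delta> powr q = \<delta> powr r" by (simp flip: powr_add)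
        moreover have "- (a * (r - q)) = - \<sigma> * r" using \<sigma>r by simp
        ultimately show ?thesis
          using D(1) \<delta> t rq q2 by (simp add: A_def K_def powr_mult powr_powr mult_ac)
      qed
      finally show ?thesis
        using K by (simp add: Lp_norm_le_def r)
    qed
    with K \<epsilon> \<sigma>0 show ?thesis by blast
  qed
qed

end
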